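(* Let $(G,\cdot)$ be a tightly network codeable (TNC) group of order $d^2$ and let $f:G\times G\to G$, $f(g,h)=g\cdot h$. Then the dense network coding protocol for $(G,\cdot)$ described in the context computes $f$ perfectly (on every input pair $(g,h)$ the receiver outputs $g\cdot h$ with probability one); that is, $P_S^f(\mathbf Q^E(d,d))=1$. Moreover, for positive integers $d_1,d_2$, $$P_S^f(\mathbf Q^E(d_1,d_2))<1\quad\text{if }\min\{d_1,d_2\}<d .$$
   Context: A group $(G,\cdot)$ of order $d^2$ is tightly network codeable (TNC) if there exist unitaries $\{U_g\}_{g\in G}$ on $\mathbb C^d$ (a TNC representation) such that $\mathrm{Tr}[U_g^\dagger U_h]=d\,\delta_{g,h}$ for all $g,h\in G$, and complex numbers $\omega(g,h)$ of modulus one such that $U_gU_h=\omega(g,h)U_{g\cdot h}$ for all $g,h\in G$. Protocol. Let $|\Phi\rangle=\frac1{\sqrt d}\sum_{i}|i\rangle|i\rangle\in\mathbb C^d\otimes\mathbb C^d$ be shared by the two senders and $|\Phi_g\rangle=(U_g\otimes I)|\Phi\rangle$ (these form an orthonormal basis of $\mathbb C^d\otimes\mathbb C^d$). On input $g$, Sender 1 applies $U_g$ to their half; on input $h$, Sender 2 applies the transpose $U_h^T$ to their half; both forward their systems noiselessly to the receiver, who measures in the basis $\{|\Phi_g\rangle\}_{g\in G}$ and outputs the label obtained. Networks. All Hilbert spaces are finite-dimensional. $\mathbf Q^E(d_1,d_2)$ is the set of conditional distributions $Q(z|x,y)=\mathrm{Tr}[\Pi_z(\mathcal E^x\otimes\mathcal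 F^y)(\rho_{AB})]$ where $\rho_{AB}$ is a bipartite quantum state on arbitrary systems $A,B$, $\mathcal E^x$ are quantum channels from $A$ to $\mathbb C^{d_1}$, $\mathcal F^y$ quantum channels from $B$ to $\mathbb C^{d_2}$, and $\{\Pi_z\}_z$ a POVM on $\mathbb C^{d_1}\otimes\mathbb C^{d_2}$. For $f:\mathcal X\times\mathcal Y\to\mathcal Z$, $P_S^f(Q)=\frac1{|\mathcal X||\mathcal Y|}\sum_{x,y}Q(f(x,y)|x,y)$ and $P_S^f(\mathbf S)=\sup_{Q\in\mathbf S}P_S^f(Q)$. *)

theory Defs
  imports
    "HOL-Algebra.Coset"
    "Jordan_Normal_Form.Schur_Decomposition"
begin

text \<open>
  Operators on an n-dimensional Hilbert space are elements of \<open>carrier_mat n n\<close>. On a product of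
  spaces of dimensions m and n, the product basis vector built from the basis vectors i and k
  has index \<open>i * n + k\<close>. On \<open>complex\<close>, \<open>w \<le> z\<close> requires equal imaginary parts, so
  \<open>0 \<le> z\<close> means that \<open>z\<close> is real and nonnegative.
\<close>

definition mtrace :: "complex mat \<Rightarrow> complex" where
  "mtrace A = (\<Sum>i<dim_row A. A $$ (i, i))"

definition unitary_mat :: "nat \<Rightarrow> complex mat \<Rightarrow> bool" where
  "unitary_mat n U \<longleftrightarrow> U \<in> carrier_mat n n \<and>
     mat_adjoint U * U = 1\<^sub>m n \<and> U * mat_adjoint U = 1\<^sub>m n"

definition psd_mat :: "nat \<Rightarrow> complex mat \<Rightarrow> bool" where
  "psd_mat n A \<longleftrightarrow> A \<in> carrier_mat n n \<and> (\<forall>v\<in>carrier_vec n. 0 \<le> (A *\<^sub>v v) \<bullet>c v)"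

definition density_mat :: "nat \<Rightarrow> complex mat \<Rightarrow> bool" where
  "density_mat n \<rho> \<longleftrightarrow> psd_mat n \<rho> \<and> mtrace \<rho> = 1"

definition kron :: "complex mat \<Rightarrow> complex mat \<Rightarrow> complex mat" where
  "kron A B = mat (dim_row A * dim_row B) (dim_col A * dim_col B)
     (\<lambda>(i, j). A $$ (i div dim_row B, j div dim_col B) * B $$ (i mod dim_row B, j mod dim_col B))"

definition rank1_proj :: "complex vec \<Rightarrow> complex mat" where
  "rank1_proj v = mat (dim_vec v) (dim_vec v) (\<lambda>(i, j). v $ i * cnj (v $ j))"

definition elem_mat :: "nat \<Rightarrow> nat \<Rightarrow> nat \<Rightarrow> complex mat" where
  "elem_mat n i j = mat n n (\<lambda>(a, b). if a = i \<and> b = j then 1 else 0)"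

definition linear_mat_map :: "nat \<Rightarrow> nat \<Rightarrow> (complex mat \<Rightarrow> complex mat) \<Rightarrow> bool" where
  "linear_mat_map m n E \<longleftrightarrow>
     (\<forall>A\<in>carrier_mat m m. E A \<in> carrier_mat n n) \<and>
     (\<forall>A\<in>carrier_mat m m. \<forall>B\<in>carrier_mat m m. E (A + B) = E A + E B) \<and>
     (\<forall>c. \<forall>A\<in>carrier_mat m m. E (c \<cdot>\<^sub>m A) = c \<cdot>\<^sub>m E A)"

text \<open>
  The tensor product of linear maps E from m1-by-m1 to n1-by-n1 matrices and F from m2-by-m2 to
  n2-by-n2 matrices: the linear extension of \<open>kron A B \<mapsto> kron (E A) (F B)\<close>, computed by
  expanding the argument in the basis of Kronecker products of elementary matrices.
\<close>

definition tensor_map :: "nat \<Rightarrow> nat \<Rightarrow> nat \<Rightarrow> nat \<Rightarrow> (complex mat \<Rightarrow> complex mat) \<Rightarrow>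
    (complex mat \<Rightarrow> complex mat) \<Rightarrow> complex mat \<Rightarrow> complex mat" where
  "tensor_map m1 m2 n1 n2 E F \<rho> = mat (n1 * n2) (n1 * n2) (\<lambda>rc.
     \<Sum>i<m1. \<Sum>j<m1. \<Sum>k<m2. \<Sum>l<m2.
       \<rho> $$ (i * m2 + k, j * m2 + l) * kron (E (elem_mat m1 i j)) (F (elem_mat m2 k l)) $$ rc)"

definition completely_positive :: "nat \<Rightarrow> nat \<Rightarrow> (complex mat \<Rightarrow> complex mat) \<Rightarrow> bool" where
  "completely_positive m n E \<longleftrightarrow>
     (\<forall>k X. psd_mat (k * m) X \<longrightarrow> psd_mat (k * n) (tensor_map k m k n (\<lambda>A. A) E X))"

definition quantum_channel :: "nat \<Rightarrow> nat \<Rightarrow> (complex mat \<Rightarrow> complex mat) \<Rightarrow> bool" where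
  "quantum_channel m n E \<longleftrightarrow> linear_mat_map m n E \<and> completely_positive m n E \<and>
     (\<forall>A\<in>carrier_mat m m. mtrace (E A) = mtrace A)"

definition povm :: "nat \<Rightarrow> 'z set \<Rightarrow> ('z \<Rightarrow> complex mat) \<Rightarrow> bool" where
  "povm n Z M \<longleftrightarrow> finite Z \<and> (\<forall>z\<in>Z. psd_mat n (M z)) \<and>
     mat n n (\<lambda>ij. \<Sum>z\<in>Z. M z $$ ij) = 1\<^sub>m n"

text \<open>
  A conditional distribution \<open>Q(z|x,y)\<close> is a function \<open>Q z x y\<close>. The trace below is a
  nonnegative real number for valid data, so taking the real part only changes its type.
\<close>

definition network_dist :: "nat \<Rightarrow> nat \<Rightarrow> nat \<Rightarrow> nat \<Rightarrow> complex mat \<Rightarrow>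
    ('x \<Rightarrow> complex mat \<Rightarrow> complex mat) \<Rightarrow> ('y \<Rightarrow> complex mat \<Rightarrow> complex mat) \<Rightarrow>
    ('z \<Rightarrow> complex mat) \<Rightarrow> 'z \<Rightarrow> 'x \<Rightarrow> 'y \<Rightarrow> real" where
  "network_dist dA dB d1 d2 \<rho> E F M z x y =
     Re (mtrace (M z * tensor_map dA dB d1 d2 (E x) (F y) \<rho>))"

text \<open>Only the values of a member at arguments in X, Y and Z are meaningful.\<close>

definition QE :: "'x set \<Rightarrow> 'y set \<Rightarrow> 'z set \<Rightarrow> nat \<Rightarrow> nat \<Rightarrow> ('z \<Rightarrow> 'x \<Rightarrow> 'y \<Rightarrow> real) set" where
  "QE X Y Z d1 d2 = {network_dist dA dB d1 d2 \<rho> E F M | dA dB \<rho> E F M.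
     density_mat (dA * dB) \<rho> \<and>
     (\<forall>x\<in>X. quantum_channel dA d1 (E x)) \<and>
     (\<forall>y\<in>Y. quantum_channel dB d2 (F y)) \<and>
     povm (d1 * d2) Z M}"

definition success_prob :: "'x set \<Rightarrow> 'y set \<Rightarrow> ('x \<Rightarrow> 'y \<Rightarrow> 'z) \<Rightarrow> ('z \<Rightarrow> 'x \<Rightarrow> 'y \<Rightarrow> real) \<Rightarrow> real" where
  "success_prob X Y f Q = (\<Sum>x\<in>X. \<Sum>y\<in>Y. Q (f x y) x y) / (real (card X) * real (card Y))"

definition opt_success_prob ::
    "'x set \<Rightarrow> 'y set \<Rightarrow> ('x \<Rightarrow> 'y \<Rightarrow> 'z) \<Rightarrow> ('z \<Rightarrow> 'x \<Rightarrow> 'y \<Rightarrow> real) set \<Rightarrow> real" where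
  "opt_success_prob X Y f S = (SUP Q\<in>S. success_prob X Y f Q)"

definition tnc_rep :: "('a, 'b) monoid_scheme \<Rightarrow> nat \<Rightarrow> ('a \<Rightarrow> complex mat) \<Rightarrow> bool" where
  "tnc_rep G d U \<longleftrightarrow>
     (\<forall>g\<in>carrier G. unitary_mat d (U g)) \<and>
     (\<forall>g\<in>carrier G. \<forall>h\<in>carrier G.
        mtrace (mat_adjoint (U g) * U h) = (if g = h then of_nat d else 0)) \<and>
     (\<exists>\<omega> :: 'a \<Rightarrow> 'a \<Rightarrow> complex. \<forall>g\<in>carrier G. \<forall>h\<in>carrier G.
        cmod (\<omega> g h) = 1 \<and> U g * U h = \<omega> g h \<cdot>\<^sub>m U (g \<otimes>\<^bsub>G\<^esub> h))"

text \<open>Finiteness is explicit because \<open>Coset.order\<close> is 0 for infinite groups; it forces \<open>d > 0\<close>.\<close>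

definition tnc_group :: "('a, 'b) monoid_scheme \<Rightarrow> nat \<Rightarrow> bool" where
  "tnc_group G d \<longleftrightarrow> group G \<and> finite (carrier G) \<and> Coset.order G = d\<^sup>2 \<and> (\<exists>U. tnc_rep G d U)"

definition max_ent :: "nat \<Rightarrow> complex vec" where
  "max_ent d = vec (d * d) (\<lambda>i. if i div d = i mod d then 1 / complex_of_real (sqrt (real d)) else 0)"

definition dnc_basis :: "nat \<Rightarrow> ('a \<Rightarrow> complex mat) \<Rightarrow> 'a \<Rightarrow> complex vec" where
  "dnc_basis d U g = kron (U g) (1\<^sub>m d) *\<^sub>v max_ent d"

definition conj_map :: "complex mat \<Rightarrow> complex mat \<Rightarrow> complex mat" where
  "conj_map V A = V * A * mat_adjoint V"

definition dnc_protocol :: "nat \<Rightarrow> ('a \<Rightarrow> complex mat) \<Rightarrow> 'a \<Rightarrow> 'a \<Rightarrow> 'a \<Rightarrow> real" where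
  "dnc_protocol d U = network_dist d d d d (rank1_proj (max_ent d))
     (\<lambda>g. conj_map (U g)) (\<lambda>h. conj_map (transpose_mat (U h)))
     (\<lambda>k. rank1_proj (dnc_basis d U k))"

end

theory Submission
  imports Defs
begin

text \<open>
  Perfect correctness comes from the transpose trick
  \<open>(U\<^sub>g \<otimes> U\<^sub>h\<^sup>T) |\<Phi>\<rangle> = (U\<^sub>g U\<^sub>h \<otimes> I) |\<Phi>\<rangle>\<close>. For the converse, fix the input \<open>y\<close> of Sender 2. The possible joint
  outputs \<open>\<sigma>\<^sub>x\<close> have a common marginal \<open>\<sigma>\<^sub>B\<close> on the second system and satisfy \<open>\<sigma>\<^sub>x \<le> d\<^sub>1 (I \<otimes> \<sigma>\<^sub>B)\<close>.
  Since \<open>x \<mapsto> f(x,y)\<close> is a bijection onto the outcomes, summing \<open>Tr[\<Pi>\<^sub>f\<^sub>(\<^sub>x\<^sub>,\<^sub>y\<^sub>) \<sigma>\<^sub>x]\<close> over \<open>x\<close> gives at most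
  \<open>d\<^sub>1 Tr[I \<otimes> \<sigma>\<^sub>B] = d\<^sub>1\<^sup>2\<close>, whatever the shared state. Exchanging the senders yields the same with \<open>d\<^sub>2\<close>,
  so the success probability is at most \<open>min(d\<^sub>1, d\<^sub>2)\<^sup>2 / d\<^sup>2\<close>.
\<close>

subsection \<open>Block indices\<close>

lemma block_index [simp]:
  fixes i p n :: nat
  assumes "p < n"
  shows "(i * n + p) div n = i" "(i * n + p) mod n = p"
  using assms by auto

lemma block_index_less [simp]:
  fixes i p m n :: nat
  assumes "i < m" "p < n"
  shows "i * n + p < m * n"
proof -
  have "i * n + p < (i + 1) * n" using assms by simp
  also have "\<dots> \<le> m * n" using assms by (intro mult_le_mono1) simp
  finally show ?thesis .
qed

lemma block_index_cases:
  fixes r m n :: nat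
  assumes "r < m * n"
  obtains i p where "i < m" "p < n" "r = i * n + p"
proof
  show "r div n < m" using assms by (simp add: less_mult_imp_div_less)
  show "r mod n < n" using assms by (cases "n = 0") auto
  show "r = r div n * n + r mod n" by simp
qed

lemma sum_blocks:
  fixes f :: "nat \<Rightarrow> 'a::comm_monoid_add"
  shows "(\<Sum>r<m * n. f r) = (\<Sum>i<m. \<Sum>p<n. f (i * n + p))"
proof (cases "n = 0")
  case False
  have "(\<Sum>i<m. \<Sum>p<n. f (i * n + p)) = (\<Sum>(i, p)\<in>{..<m} \<times> {..<n}. f (i * n + p))"
    by (simp add: sum.cartesian_product)
  also have "\<dots> = (\<Sum>r<m * n. f r)"
    by (rule sum.reindex_bij_witness[where i = "\<lambda>r. (r div n, r mod n)" and j = "\<lambda>(i, p). i * n + p"])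
      (use False in \<open>auto simp: less_mult_imp_div_less\<close>)
  finally show ?thesis by simp
qed simp

lemma eq_mat_blocksI:
  assumes "A \<in> carrier_mat (m * n) (m * n)" "B \<in> carrier_mat (m * n) (m * n)"
    and "\<And>i j p q. i < m \<Longrightarrow> j < m \<Longrightarrow> p < n \<Longrightarrow> q < n \<Longrightarrow>
      A $$ (i * n + p, j * n + q) = B $$ (i * n + p, j * n + q)"
  shows "A = B"
proof (rule eq_matI)
  fix r c assume "r < dim_row B" "c < dim_col B"
  with assms(2) have "r < m * n" "c < m * n" by auto
  then show "A $$ (r, c) = B $$ (r, c)"
    by (elim block_index_cases) (use assms(3) in auto)
qed (use assms in auto)

subsection \<open>Traces and adjoints by entries\<close>

lemma mat_adjoint_index [simp]:
  "i < dim_col A \<Longrightarrow> j < dim_row A \<Longrightarrow> mat_adjoint A $$ (i, j) = conjugate (A $$ (j, i))"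
  unfolding mat_adjoint_def by (simp add: mat_of_rows_index)

lemma mat_adjoint_dim [simp]:
  "dim_row (mat_adjoint A) = dim_col A" "dim_col (mat_adjoint A) = dim_row A"
  unfolding mat_adjoint_def by simp_all

lemma mat_adjoint_carrier [simp]:
  "A \<in> carrier_mat m n \<Longrightarrow> mat_adjoint A \<in> carrier_mat n m"
  by auto

lemma times_mat_index_sum:
  assumes "A \<in> carrier_mat m n" "B \<in> carrier_mat n k" "i < m" "j < k"
  shows "(A * B) $$ (i, j) = (\<Sum>r<n. A $$ (i, r) * B $$ (r, j))"
  using assms by (simp add: scalar_prod_def atLeast0LessThan)

lemma mtrace_times:
  assumes "A \<in> carrier_mat m n" "B \<in> carrier_mat n m"
  shows "mtrace (A * B) = (\<Sum>r<m. \<Sum>c<n. A $$ (r, c) * B $$ (c, r))"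
  unfolding mtrace_def using assms
  by (auto intro!: sum.cong simp: times_mat_index_sum[OF assms] simp del: index_mult_mat(1))

lemma mtrace_times_commute:
  assumes "A \<in> carrier_mat m n" "B \<in> carrier_mat n m"
  shows "mtrace (A * B) = mtrace (B * A)"
  unfolding mtrace_times[OF assms] mtrace_times[OF assms(2,1)]
  by (subst sum.swap) (simp add: mult.commute)

lemma mtrace_conj_map:
  assumes "K \<in> carrier_mat m n" "X \<in> carrier_mat n n"
  shows "mtrace (K * X * mat_adjoint K) = mtrace (mat_adjoint K * K * X)"
proof -
  have "mtrace (K * X * mat_adjoint K) = mtrace (mat_adjoint K * (K * X))"
    by (rule mtrace_times_commute[where m = m and n = n]) (use assms in auto)
  also have "mat_adjoint K * (K * X) = mat_adjoint K * K * X"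
    by (rule assoc_mult_mat[symmetric]) (use assms in auto)
  finally show ?thesis .
qed

subsection \<open>Positive semidefinite matrices\<close>

text \<open>The Hermitian form <A v, v>, with entries and arguments as plain functions, so that
  elimination can change single coordinates and split off the last index without carrier
  conditions.\<close>

definition qform :: "nat \<Rightarrow> (nat \<Rightarrow> nat \<Rightarrow> complex) \<Rightarrow> (nat \<Rightarrow> complex) \<Rightarrow> complex" where
  "qform n a v = (\<Sum>r<n. \<Sum>c<n. a r c * v c * cnj (v r))"

lemma qform_mat:
  assumes "A \<in> carrier_mat n n" "v \<in> carrier_vec n"
  shows "(A *\<^sub>v v) \<bullet>c v = qform n (\<lambda>r c. A $$ (r, c)) (\<lambda>r. v $ r)"
  using assms unfolding qform_def
  by (auto simp: scalar_prod_def atLeast0LessThan sum_distrib_right intro!: sum.cong)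

text \<open>Only the values of v below n enter the form, so carrier vectors may be traded for
  arbitrary functions.\<close>

lemma psd_mat_iff:
  "psd_mat n A \<longleftrightarrow> A \<in> carrier_mat n n \<and> (\<forall>v. 0 \<le> qform n (\<lambda>r c. A $$ (r, c)) v)"
proof -
  have "0 \<le> qform n (\<lambda>r c. A $$ (r, c)) v"
    if A: "A \<in> carrier_mat n n" and *: "\<forall>v\<in>carrier_vec n. 0 \<le> (A *\<^sub>v v) \<bullet>c v" for v
  proof -
    have "0 \<le> (A *\<^sub>v vec n v) \<bullet>c vec n v" using * by simp
    also have "\<dots> = qform n (\<lambda>r c. A $$ (r, c)) v"
      by (subst qform_mat[OF A]) (auto simp: qform_def intro!: sum.cong)
    finally show ?thesis .
  qed
  then show ?thesis unfolding psd_mat_def by (auto simp: qform_mat)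
qed

lemma psd_mat_carrier: "psd_mat n A \<Longrightarrow> A \<in> carrier_mat n n"
  by (simp add: psd_mat_def)

lemma nonneg_complex_iff: "(0::complex) \<le> z \<longleftrightarrow> 0 \<le> Re z \<and> Im z = 0"
  by (auto simp: less_eq_complex_def)

lemma mult_cnj_nonneg: "(0::complex) \<le> z * cnj z"
  by (simp add: nonneg_complex_iff)

text \<open>Cholesky elimination: subtract the rank-one matrix that clears the last row and column.\<close>

lemma gram_decomposition:
  assumes "\<And>v. 0 \<le> qform n a v"
  shows "\<exists>u :: nat \<Rightarrow> nat \<Rightarrow> complex. \<forall>r<n. \<forall>c<n. a r c = (\<Sum>k<n. u k r * cnj (u k c))"
  using assms
proof (induction n arbitrary: a)
  case 0
  then show ?case by simp
next
  case (Suc n)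
  note pos = Suc.prems
  have expand: "qform (Suc n) a v = qform n a v + (\<Sum>c<n. a n c * v c) * cnj (v n)
      + (\<Sum>r<n. a r n * cnj (v r)) * v n + a n n * v n * cnj (v n)" for v
    by (simp add: qform_def sum.distrib sum_distrib_left sum_distrib_right algebra_simps)
  define p where "p = a n n"
  have p0: "0 \<le> p"
    using pos[of "\<lambda>i. if i = n then 1 else 0"] unfolding expand by (simp add: qform_def p_def)
  \<comment> \<open>The test vector with 1 at r and z at n probes a 2 by 2 principal submatrix; the
    choices of z below yield Hermitian symmetry and the behaviour at a zero pivot.\<close>
  have entries: "0 \<le> a r r + a n r * cnj z + a r n * z + p * z * cnj z" if "r < n" for r z
  proof -
    define v where "v i = (if i = r then 1 else if i = n then z else 0)" for i
    have v: "v r = 1" "v n = z" using that by (auto simp: v_def)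
    have single: "(\<Sum>i<n. f i * v i) = f r" "(\<Sum>i<n. f i * cnj (v i)) = f r" for f
    proof -
      have "f i * v i = (if i = r then f r else 0)" "f i * cnj (v i) = (if i = r then f r else 0)"
        if "i < n" for i using that by (auto simp: v_def)
      then show "(\<Sum>i<n. f i * v i) = f r" "(\<Sum>i<n. f i * cnj (v i)) = f r"
        using that by simp_all
    qed
    have "qform n a v = a r r"
      by (simp add: qform_def single sum_distrib_right[symmetric])
    then show ?thesis
      using pos[of v] unfolding expand by (simp add: single v p_def)
  qed
  have herm: "a r n = cnj (a n r)" if "r < n" for r
  proof -
    have "Im (a r r) = 0" "Im p = 0"
      using entries[OF that, of 0] p0 by (simp_all add: nonneg_complex_iff)
    \<comment> \<open>Vanishing imaginary parts at z = 1 and z = \<i> compare the imaginary and the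
      real parts of the two entries.\<close>
    with entries[OF that, of 1] entries[OF that, of \<i>] show ?thesis
      by (auto simp: nonneg_complex_iff complex_eq_iff)
  qed
  have zero: "a n r = 0" if "r < n" "p = 0" for r
  proof (rule ccontr)
    assume "a n r \<noteq> 0"
    \<comment> \<open>With a zero pivot the form at \<open>z = - t * a n r\<close> is affine in t
      with negative slope; this t brings its real part to \<open>- Re (a r r) - 2\<close>.\<close>
    define t where "t = (Re (a r r) + 1) / (cmod (a n r))\<^sup>2"
    have "0 \<le> Re (a r r + a n r * cnj (- of_real t * a n r) + a r n * (- of_real t * a n r))"
      using entries[OF that(1), of "- of_real t * a n r"] that(2) by (simp add: nonneg_complex_iff)
    also have "\<dots> = Re (a r r) - 2 * t * (cmod (a n r))\<^sup>2"
      unfolding cmod_power2 by (simp add: herm[OF that(1)] algebra_simps power2_eq_square)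
    also have "\<dots> < 0"
      using \<open>a n r \<noteq> 0\<close> entries[OF that(1), of 0] by (simp add: t_def nonneg_complex_iff)
    finally show False by simp
  qed
  \<comment> \<open>The Schur complement of the pivot. For p = 0 the quotient is 0 and b equals a,
    in accordance with \<open>zero\<close>.\<close>
  define b where "b r c = a r c - a r n * a n c / p" for r c
  have "0 \<le> qform n b v" for v
  proof -
    define l where "l = (\<Sum>c<n. a n c * v c)"
    \<comment> \<open>For p > 0 the value \<open>- l / p\<close> minimizes the form over the last
      coordinate, and the minimum is the form of b at v. For p = 0 the value is 0.\<close>
    define w where "w = v(n := - l / p)"
    have cl: "(\<Sum>r<n. a r n * cnj (v r)) = cnj l"
      by (simp add: l_def herm)
    have "qform n b v = qform n a v - (\<Sum>r<n. \<Sum>c<n. (a r n * cnj (v r)) * (a n c * v c)) / p"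
      by (simp add: qform_def b_def sum_subtractf sum_divide_distrib algebra_simps)
    also have "\<dots> = qform n a v - cnj l * l / p"
      by (simp only: cl[symmetric]) (simp add: l_def sum_product)
    also have "\<dots> = qform (Suc n) a w"
    proof -
      have "qform n a w = qform n a v" "(\<Sum>c<n. a n c * w c) = l" "(\<Sum>r<n. a r n * cnj (w r)) = cnj l"
        by (auto simp: w_def l_def qform_def cl[unfolded l_def] intro!: sum.cong)
      moreover have "cnj p = p"
        using p0 by (simp add: nonneg_complex_iff complex_eq_iff)
      then have "w n = - l / p" "cnj (w n) = - cnj l / p"
        by (simp_all add: w_def)
      moreover have "q - k * l / p = q + l * (- k / p) + k * (- l / p) + p * (- l / p) * (- k / p)" for q k
        by (cases "p = 0") (simp_all add: field_simps)
      ultimately show ?thesis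
        unfolding expand p_def[symmetric] by metis
    qed
    finally show ?thesis using pos by simp
  qed
  from Suc.IH[OF this] obtain u where u: "\<And>r c. r < n \<Longrightarrow> c < n \<Longrightarrow> b r c = (\<Sum>k<n. u k r * cnj (u k c))"
    by blast
  define s where "s = complex_of_real (sqrt (Re p))"
  have s: "s * s = p" "cnj s = s"
    using p0 by (auto simp: s_def nonneg_complex_iff complex_eq_iff)
  \<comment> \<open>The new Gram vector is the last column divided by the root of the pivot; the
    earlier vectors are padded with 0 at coordinate n.\<close>
  define u' where "u' k r = (if k = n then a r n / s else if r = n then 0 else u k r)" for k r
  have "a r c = (\<Sum>k<Suc n. u' k r * cnj (u' k c))" if "r < Suc n" "c < Suc n" for r c
  proof -
    have head: "(\<Sum>k<n. u' k r * cnj (u' k c)) = (if r = n \<or> c = n then 0 else b r c)"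
      using that by (auto simp: u'_def u)
    have last: "u' n r * cnj (u' n c) = a r n * cnj (a c n) / p"
      by (simp add: u'_def s)
    have "cnj (a c n) = a n c"
      using that herm[of c] p0 by (cases "c = n") (auto simp: p_def nonneg_complex_iff complex_eq_iff)
    \<comment> \<open>A zero pivot makes the new Gram vector zero, which is correct because the last
      row and column then vanish.\<close>
    moreover have "a r n = 0" "a n c = 0" if "p = 0"
      using \<open>r < Suc n\<close> \<open>c < Suc n\<close> that zero herm by (auto simp: p_def less_Suc_eq)
    ultimately show ?thesis
      using that unfolding sum.lessThan_Suc head last
      by (cases "p = 0") (auto simp: b_def p_def less_Suc_eq)
  qed
  then show ?case by blast
qed

lemma psd_mat_gram:
  assumes "psd_mat n A"
  obtains u where "\<And>r c. r < n \<Longrightarrow> c < n \<Longrightarrow> A $$ (r, c) = (\<Sum>k<n. u k r * cnj (u k c))"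
  using gram_decomposition[of n "\<lambda>r c. A $$ (r, c)"] assms unfolding psd_mat_iff by blast

text \<open>Writing B as a sum of rank-one matrices turns the trace into a sum of values of the
  Hermitian form of A at the Gram vectors of B.\<close>

lemma mtrace_times_psd:
  assumes "psd_mat n A" "psd_mat n B"
  shows "0 \<le> mtrace (A * B)"
proof -
  from psd_mat_gram[OF assms(2)] obtain u where
    u: "\<And>r c. r < n \<Longrightarrow> c < n \<Longrightarrow> B $$ (r, c) = (\<Sum>k<n. u k r * cnj (u k c))" by blast
  have "mtrace (A * B) = (\<Sum>r<n. \<Sum>c<n. \<Sum>k<n. A $$ (r, c) * u k c * cnj (u k r))"
    by (simp add: mtrace_times[OF assms[THEN psd_mat_carrier]] u sum_distrib_left mult.assoc)
  also have "\<dots> = (\<Sum>k<n. qform n (\<lambda>r c. A $$ (r, c)) (u k))"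
  proof -
    have "(\<Sum>r<n. \<Sum>c<n. \<Sum>k<n. f r c k) = (\<Sum>k<n. \<Sum>r<n. \<Sum>c<n. f r c k)"
      for f :: "nat \<Rightarrow> nat \<Rightarrow> nat \<Rightarrow> complex"
    proof -
      have "(\<Sum>r<n. \<Sum>c<n. \<Sum>k<n. f r c k) = (\<Sum>r<n. \<Sum>k<n. \<Sum>c<n. f r c k)"
        by (intro sum.cong refl sum.swap)
      also have "\<dots> = (\<Sum>k<n. \<Sum>r<n. \<Sum>c<n. f r c k)" by (rule sum.swap)
      finally show ?thesis .
    qed
    then show ?thesis unfolding qform_def .
  qed
  finally show ?thesis
    using assms(1) by (auto simp: psd_mat_iff intro!: sum_nonneg)
qed

lemma inner_mult_mat_vec:
  assumes "B \<in> carrier_mat m n" "w \<in> carrier_vec n" "v \<in> carrier_vec m"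
  shows "(B *\<^sub>v w) \<bullet>c v = w \<bullet>c (mat_adjoint B *\<^sub>v (v :: complex vec))"
proof -
  have "(B *\<^sub>v w) \<bullet>c v = (\<Sum>r<m. \<Sum>c<n. B $$ (r, c) * w $ c * cnj (v $ r))"
    using assms by (auto simp: scalar_prod_def atLeast0LessThan sum_distrib_right intro!: sum.cong)
  also have "\<dots> = (\<Sum>c<n. \<Sum>r<m. B $$ (r, c) * w $ c * cnj (v $ r))" by (rule sum.swap)
  also have "\<dots> = w \<bullet>c (mat_adjoint B *\<^sub>v v)"
    using assms by (auto simp: scalar_prod_def atLeast0LessThan sum_distrib_left algebra_simps intro!: sum.cong)
  finally show ?thesis .
qed

text \<open>The form of the conjugated matrix at v is the form of X at
  \<open>mat_adjoint K *\<^sub>v v\<close>.\<close>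

lemma psd_mat_conj:
  assumes "psd_mat n X" "K \<in> carrier_mat m n"
  shows "psd_mat m (K * X * mat_adjoint K)"
  unfolding psd_mat_def
proof (intro conjI ballI)
  note X = psd_mat_carrier[OF assms(1)]
  show "K * X * mat_adjoint K \<in> carrier_mat m m" using X assms by auto
  fix v :: "complex vec" assume v: "v \<in> carrier_vec m"
  have w: "mat_adjoint K *\<^sub>v v \<in> carrier_vec n" by (rule mult_mat_vec_carrier[where n = m]) (use assms v in auto)
  have "K * X * mat_adjoint K *\<^sub>v v = K * X *\<^sub>v (mat_adjoint K *\<^sub>v v)"
    by (rule assoc_mult_mat_vec) (use assms X v in auto)
  also have "\<dots> = K *\<^sub>v (X *\<^sub>v (mat_adjoint K *\<^sub>v v))"
    by (rule assoc_mult_mat_vec) (use assms X w in auto)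
  finally have "(K * X * mat_adjoint K *\<^sub>v v) \<bullet>c v = (X *\<^sub>v (mat_adjoint K *\<^sub>v v)) \<bullet>c (mat_adjoint K *\<^sub>v v)"
    using inner_mult_mat_vec[OF assms(2), of "X *\<^sub>v (mat_adjoint K *\<^sub>v v)" v] X w v by simp
  then show "0 \<le> (K * X * mat_adjoint K *\<^sub>v v) \<bullet>c v"
    using assms w by (simp add: psd_mat_def)
qed

subsection \<open>Tensor products of maps\<close>

lemma elem_mat_carrier [simp]: "elem_mat n i j \<in> carrier_mat n n"
  by (simp add: elem_mat_def)

lemma elem_mat_index:
  "a < n \<Longrightarrow> b < n \<Longrightarrow> elem_mat n i j $$ (a, b) = (if a = i \<and> b = j then 1 else 0)"
  by (simp add: elem_mat_def)

lemma kron_index: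
  assumes "A \<in> carrier_mat m1 n1" "B \<in> carrier_mat m2 n2" "a < m1" "b < n1" "p < m2" "q < n2"
  shows "kron A B $$ (a * m2 + p, b * n2 + q) = A $$ (a, b) * B $$ (p, q)"
  using assms by (auto simp: kron_def)

lemma kron_carrier [simp]:
  "A \<in> carrier_mat m1 n1 \<Longrightarrow> B \<in> carrier_mat m2 n2 \<Longrightarrow> kron A B \<in> carrier_mat (m1 * m2) (n1 * n2)"
  by (auto simp: kron_def)

lemma tensor_map_carrier [simp]:
  "tensor_map m1 m2 n1 n2 E F \<rho> \<in> carrier_mat (n1 * n2) (n1 * n2)"
  by (simp add: tensor_map_def)

text \<open>\<open>tensor_map\<close> sees a map only through its values on elementary matrices, so
  this size condition is what the entry formulas rest on; it applies to conjugations before they are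
  known to be channels.\<close>

definition sized_map :: "nat \<Rightarrow> nat \<Rightarrow> (complex mat \<Rightarrow> complex mat) \<Rightarrow> bool" where
  "sized_map m n E \<longleftrightarrow> (\<forall>A\<in>carrier_mat m m. E A \<in> carrier_mat n n)"

lemma sized_map_id [simp]: "sized_map n n (\<lambda>A. A)"
  by (simp add: sized_map_def)

lemma sized_map_channel: "quantum_channel m n E \<Longrightarrow> sized_map m n E"
  by (simp add: quantum_channel_def linear_mat_map_def sized_map_def)

lemma tensor_map_index:
  assumes "sized_map m1 n1 E" "sized_map m2 n2 F" "a < n1" "b < n1" "p < n2" "q < n2"
  shows "tensor_map m1 m2 n1 n2 E F \<rho> $$ (a * n2 + p, b * n2 + q) =
    (\<Sum>i<m1. \<Sum>j<m1. \<Sum>k<m2. \<Sum>l<m2. \<rho> $$ (i * m2 + k, j * m2 + l) *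
      (E (elem_mat m1 i j) $$ (a, b) * F (elem_mat m2 k l) $$ (p, q)))"
proof -
  have "kron (E (elem_mat m1 i j)) (F (elem_mat m2 k l)) $$ (a * n2 + p, b * n2 + q) =
      E (elem_mat m1 i j) $$ (a, b) * F (elem_mat m2 k l) $$ (p, q)" for i j k l
    by (rule kron_index) (use assms in \<open>auto simp: sized_map_def\<close>)
  then show ?thesis
    using assms by (simp add: tensor_map_def)
qed

lemma sum_delta2:
  fixes a b m n :: nat
  assumes "a < m" "b < n"
  shows "(\<Sum>i<m. \<Sum>j<n. if a = i \<and> b = j then f i j else 0) = (f a b :: complex)"
proof -
  have "(\<Sum>j<n. if a = i \<and> b = j then f i j else 0) = (if a = i then f i b else 0)" for i
    using assms by simp
  then show ?thesis using assms by simp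
qed

text \<open>The (a, b) entry of an elementary matrix is a Kronecker delta, so only block (a, b) of
  the argument survives and F acts on it.\<close>

lemma tensor_map_id_left_index:
  assumes "sized_map m2 n2 F" "a < m1" "b < m1" "p < n2" "q < n2"
  shows "tensor_map m1 m2 m1 n2 (\<lambda>A. A) F \<rho> $$ (a * n2 + p, b * n2 + q) =
    (\<Sum>k<m2. \<Sum>l<m2. \<rho> $$ (a * m2 + k, b * m2 + l) * F (elem_mat m2 k l) $$ (p, q))"
proof -
  have "tensor_map m1 m2 m1 n2 (\<lambda>A. A) F \<rho> $$ (a * n2 + p, b * n2 + q) =
    (\<Sum>i<m1. \<Sum>j<m1. if a = i \<and> b = j then
       (\<Sum>k<m2. \<Sum>l<m2. \<rho> $$ (i * m2 + k, j * m2 + l) * F (elem_mat m2 k l) $$ (p, q)) else 0)"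
    unfolding tensor_map_index[OF sized_map_id assms]
    by (intro sum.cong refl) (simp add: elem_mat_index assms)
  also have "\<dots> = (\<Sum>k<m2. \<Sum>l<m2. \<rho> $$ (a * m2 + k, b * m2 + l) * F (elem_mat m2 k l) $$ (p, q))"
    by (rule sum_delta2) fact+
  finally show ?thesis .
qed

text \<open>Conjugation by the unitary that exchanges the factors of dimensions \<open>m\<close> and \<open>n\<close>.\<close>

definition swap_mat :: "nat \<Rightarrow> nat \<Rightarrow> complex mat \<Rightarrow> complex mat" where
  "swap_mat m n X = mat (n * m) (n * m)
     (\<lambda>(r, c). X $$ ((r mod m) * n + r div m, (c mod m) * n + c div m))"

lemma swap_mat_carrier [simp]: "swap_mat m n X \<in> carrier_mat (n * m) (n * m)"
  by (simp add: swap_mat_def)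

lemma swap_mat_index [simp]:
  assumes "i < m" "j < m" "p < n" "q < n"
  shows "swap_mat m n X $$ (p * m + i, q * m + j) = X $$ (i * n + p, j * n + q)"
  using assms by (simp add: swap_mat_def)

lemma sum_blocks_swap:
  fixes f :: "nat \<Rightarrow> 'a::comm_monoid_add"
  shows "(\<Sum>r<n * m. f r) = (\<Sum>i<m. \<Sum>p<n. f (p * m + i))"
  unfolding sum_blocks by (rule sum.swap)

text \<open>Relabelling the basis: the form of the swapped matrix at v is the form of X at the
  permuted v.\<close>

lemma psd_mat_swap:
  assumes "psd_mat (m * n) X"
  shows "psd_mat (n * m) (swap_mat m n X)"
  unfolding psd_mat_iff
proof (intro conjI allI)
  fix v :: "nat \<Rightarrow> complex"
  have "qform (n * m) (\<lambda>r c. swap_mat m n X $$ (r, c)) v =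
    qform (m * n) (\<lambda>r c. X $$ (r, c)) (\<lambda>r. v ((r mod n) * m + r div n))"
    unfolding qform_def sum_blocks_swap[where n = n and m = m] sum_blocks[where n = n and m = m] by simp
  then show "0 \<le> qform (n * m) (\<lambda>r c. swap_mat m n X $$ (r, c)) v"
    using assms by (simp add: psd_mat_iff)
qed simp

lemma mtrace_swap:
  assumes "A \<in> carrier_mat (m * n) (m * n)"
  shows "mtrace (swap_mat m n A) = mtrace A"
proof -
  have "mtrace (swap_mat m n A) = (\<Sum>r<n * m. swap_mat m n A $$ (r, r))"
    unfolding mtrace_def by (simp add: swap_mat_def)
  also have "\<dots> = (\<Sum>r<m * n. A $$ (r, r))"
    unfolding sum_blocks_swap[where n = n and m = m] sum_blocks[where n = n and m = m] by simp
  finally show ?thesis using assms unfolding mtrace_def by simp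
qed

lemma mtrace_swap_times:
  assumes "A \<in> carrier_mat (m * n) (m * n)" "B \<in> carrier_mat (m * n) (m * n)"
  shows "mtrace (swap_mat m n A * swap_mat m n B) = mtrace (A * B)"
  unfolding mtrace_times[OF assms] mtrace_times[OF swap_mat_carrier swap_mat_carrier]
  unfolding sum_blocks_swap[where n = n and m = m] sum_blocks[where n = n and m = m] by simp

text \<open>Carries facts about one tensor factor over to the other.\<close>

lemma tensor_map_swap:
  assumes "sized_map m1 n1 E" "sized_map m2 n2 F"
  shows "tensor_map m2 m1 n2 n1 F E (swap_mat m1 m2 \<rho>) = swap_mat n1 n2 (tensor_map m1 m2 n1 n2 E F \<rho>)"
proof (rule eq_mat_blocksI)
  fix a b p q assume "p < n1" "q < n1" "a < n2" "b < n2"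
  have "(\<Sum>k<m2. \<Sum>l<m2. \<Sum>i<m1. \<Sum>j<m1. g k l i j) = (\<Sum>i<m1. \<Sum>j<m1. \<Sum>k<m2. \<Sum>l<m2. g k l i j)"
    for g :: "nat \<Rightarrow> nat \<Rightarrow> nat \<Rightarrow> nat \<Rightarrow> complex"
  proof -
    have "(\<Sum>x\<in>{..<m2} \<times> {..<m2}. \<Sum>y\<in>{..<m1} \<times> {..<m1}. g (fst x) (snd x) (fst y) (snd y)) =
        (\<Sum>y\<in>{..<m1} \<times> {..<m1}. \<Sum>x\<in>{..<m2} \<times> {..<m2}. g (fst x) (snd x) (fst y) (snd y))"
      by (rule sum.swap)
    then show ?thesis by (simp add: sum.cartesian_product')
  qed
  then show "tensor_map m2 m1 n2 n1 F E (swap_mat m1 m2 \<rho>) $$ (a * n1 + p, b * n1 + q) =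
      swap_mat n1 n2 (tensor_map m1 m2 n1 n2 E F \<rho>) $$ (a * n1 + p, b * n1 + q)"
    using \<open>p < n1\<close> \<open>q < n1\<close> \<open>a < n2\<close> \<open>b < n2\<close> assms
    by (simp add: tensor_map_index) (simp add: mult_ac)
qed auto

text \<open>Factors E \<otimes> F as E \<otimes> id after id \<otimes> F. Complete positivity is
  phrased with the ancilla on the left, so E \<otimes> id is written as id \<otimes> E between two
  swaps.\<close>

lemma tensor_map_compose:
  assumes "sized_map m1 n1 E" "sized_map m2 n2 F"
  shows "tensor_map m1 m2 n1 n2 E F \<rho> = swap_mat n2 n1 (tensor_map n2 m1 n2 n1 (\<lambda>A. A) E
    (swap_mat m1 n2 (tensor_map m1 m2 m1 n2 (\<lambda>A. A) F \<rho>)))"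
proof (rule eq_mat_blocksI)
  fix a b p q assume *: "a < n1" "b < n1" "p < n2" "q < n2"
  then show "tensor_map m1 m2 n1 n2 E F \<rho> $$ (a * n2 + p, b * n2 + q) =
    swap_mat n2 n1 (tensor_map n2 m1 n2 n1 (\<lambda>A. A) E
      (swap_mat m1 n2 (tensor_map m1 m2 m1 n2 (\<lambda>A. A) F \<rho>))) $$ (a * n2 + p, b * n2 + q)"
    using assms
    by (simp add: tensor_map_id_left_index tensor_map_index[OF assms] sum_distrib_right) (simp add: mult_ac)
qed auto

lemma psd_mat_tensor_map:
  assumes "quantum_channel m1 n1 E" "quantum_channel m2 n2 F" "psd_mat (m1 * m2) \<rho>"
  shows "psd_mat (n1 * n2) (tensor_map m1 m2 n1 n2 E F \<rho>)"
proof -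
  have "psd_mat (m1 * n2) (tensor_map m1 m2 m1 n2 (\<lambda>A. A) F \<rho>)"
    using assms by (simp add: quantum_channel_def completely_positive_def)
  then have "psd_mat (n2 * m1) (swap_mat m1 n2 (tensor_map m1 m2 m1 n2 (\<lambda>A. A) F \<rho>))"
    by (rule psd_mat_swap)
  then have "psd_mat (n2 * n1) (tensor_map n2 m1 n2 n1 (\<lambda>A. A) E
      (swap_mat m1 n2 (tensor_map m1 m2 m1 n2 (\<lambda>A. A) F \<rho>)))"
    using assms(1) by (simp add: quantum_channel_def completely_positive_def)
  then show ?thesis
    unfolding tensor_map_compose[OF assms(1,2)[THEN sized_map_channel]] by (rule psd_mat_swap)
qed

text \<open>No-signalling: trace preservation turns the diagonal sum of the E-factor into a delta,
  so E disappears from the right-hand side. The marginal of the second system carries no information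
  about the first sender's input.\<close>

lemma partial_trace_tensor_map:
  assumes "quantum_channel m1 n1 E" "sized_map m2 n2 F" "p < n2" "q < n2"
  shows "(\<Sum>a<n1. tensor_map m1 m2 n1 n2 E F \<rho> $$ (a * n2 + p, a * n2 + q)) =
    (\<Sum>i<m1. \<Sum>k<m2. \<Sum>l<m2. \<rho> $$ (i * m2 + k, i * m2 + l) * F (elem_mat m2 k l) $$ (p, q))"
proof -
  have E: "sized_map m1 n1 E" by (rule sized_map_channel) fact
  have tr: "(\<Sum>a<n1. E (elem_mat m1 i j) $$ (a, a)) = (if i = j then 1 else 0)" if "i < m1" "j < m1" for i j
  proof -
    have "(\<Sum>a<n1. E (elem_mat m1 i j) $$ (a, a)) = mtrace (E (elem_mat m1 i j))"
      using E by (simp add: mtrace_def sized_map_def carrier_matD[of "E (elem_mat m1 i j)" n1 n1])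
    also have "\<dots> = mtrace (elem_mat m1 i j)"
      using assms(1) by (simp add: quantum_channel_def)
    also have "\<dots> = (\<Sum>a<m1. if a = i \<and> a = j then 1 else 0)"
      by (simp add: mtrace_def elem_mat_def)
    also have "\<dots> = (\<Sum>a<m1. if a = i then if i = j then 1 else 0 else 0)"
      by (intro sum.cong) auto
    finally show ?thesis using that by simp
  qed
  define S where "S i j = (\<Sum>k<m2. \<Sum>l<m2. \<rho> $$ (i * m2 + k, j * m2 + l) * F (elem_mat m2 k l) $$ (p, q))" for i j
  have "(\<Sum>a<n1. tensor_map m1 m2 n1 n2 E F \<rho> $$ (a * n2 + p, a * n2 + q)) =
      (\<Sum>a<n1. \<Sum>i<m1. \<Sum>j<m1. S i j * E (elem_mat m1 i j) $$ (a, a))"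
    using assms E by (simp add: tensor_map_index S_def sum_distrib_right) (simp add: mult_ac)
  also have "\<dots> = (\<Sum>i<m1. \<Sum>a<n1. \<Sum>j<m1. S i j * E (elem_mat m1 i j) $$ (a, a))"
    by (rule sum.swap)
  also have "\<dots> = (\<Sum>i<m1. \<Sum>j<m1. S i j * (\<Sum>a<n1. E (elem_mat m1 i j) $$ (a, a)))"
    unfolding sum_distrib_left by (intro sum.cong refl sum.swap)
  also have "\<dots> = (\<Sum>i<m1. \<Sum>j<m1. if i = j then S i j else 0)"
    by (intro sum.cong refl) (simp add: tr)
  also have "\<dots> = (\<Sum>i<m1. S i i)"
    by simp
  finally show ?thesis by (simp add: S_def)
qed

lemma mtrace_blocks:
  assumes "A \<in> carrier_mat (m * n) (m * n)"
  shows "mtrace A = (\<Sum>p<n. \<Sum>i<m. A $$ (i * n + p, i * n + p))"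
  using assms unfolding mtrace_def by (simp add: sum_blocks) (rule sum.swap)

lemma mtrace_tensor_map:
  assumes "quantum_channel m1 n1 E" "quantum_channel m2 n2 F" "\<rho> \<in> carrier_mat (m1 * m2) (m1 * m2)"
  shows "mtrace (tensor_map m1 m2 n1 n2 E F \<rho>) = mtrace \<rho>"
proof -
  note EF = assms(1,2)[THEN sized_map_channel]
  \<comment> \<open>The full trace is the trace of the marginal, so the first map may be replaced by
    the identity. Doing this on both sides of a swap removes both maps.\<close>
  have step: "mtrace (tensor_map m1 m2 n1 n2 E F \<rho>) = mtrace (tensor_map m1 m2 m1 n2 (\<lambda>A. A) F \<rho>)"
    if "sized_map m2 n2 F" "quantum_channel m1 n1 E" for m1 m2 n1 n2 E F \<rho>
    using that by (simp add: mtrace_blocks[OF tensor_map_carrier] partial_trace_tensor_map tensor_map_id_left_index)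
  let ?T = "tensor_map m1 m2 m1 n2 (\<lambda>A. A) F \<rho>"
  have "mtrace ?T = mtrace (swap_mat m1 n2 ?T)" by (simp add: mtrace_swap)
  also have "swap_mat m1 n2 ?T = tensor_map m2 m1 n2 m1 F (\<lambda>A. A) (swap_mat m1 m2 \<rho>)"
    by (rule tensor_map_swap[symmetric]) (use EF in auto)
  also have "mtrace \<dots> = mtrace (tensor_map m2 m1 m2 m1 (\<lambda>A. A) (\<lambda>A. A) (swap_mat m1 m2 \<rho>))"
    by (rule step) (use assms in auto)
  also have "tensor_map m2 m1 m2 m1 (\<lambda>A. A) (\<lambda>A. A) (swap_mat m1 m2 \<rho>) = swap_mat m1 m2 \<rho>"
  proof (rule eq_mat_blocksI)
    fix a b p q assume *: "a < m2" "b < m2" "p < m1" "q < m1"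
    have "tensor_map m2 m1 m2 m1 (\<lambda>A. A) (\<lambda>A. A) (swap_mat m1 m2 \<rho>) $$ (a * m1 + p, b * m1 + q) =
       (\<Sum>k<m1. \<Sum>l<m1. if p = k \<and> q = l then swap_mat m1 m2 \<rho> $$ (a * m1 + k, b * m1 + l) else 0)"
      unfolding tensor_map_id_left_index[OF sized_map_id *]
      by (intro sum.cong refl) (simp add: elem_mat_index *)
    also have "\<dots> = swap_mat m1 m2 \<rho> $$ (a * m1 + p, b * m1 + q)"
      by (rule sum_delta2) fact+
    finally show "tensor_map m2 m1 m2 m1 (\<lambda>A. A) (\<lambda>A. A) (swap_mat m1 m2 \<rho>) $$ (a * m1 + p, b * m1 + q) =
      swap_mat m1 m2 \<rho> $$ (a * m1 + p, b * m1 + q)" .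
  qed auto
  finally show ?thesis using step[OF EF(2) assms(1)] assms by (simp add: mtrace_swap)
qed

subsection \<open>Capacity bound\<close>

text \<open>The number N of Gram vectors is independent of n because the formula is also applied to
  the n by n diagonal blocks of a larger Gram matrix.\<close>

lemma qform_gram:
  assumes "\<And>r c. r < n \<Longrightarrow> c < n \<Longrightarrow> a r c = (\<Sum>k<N. u k r * cnj (u k c))"
  shows "qform n a v = of_real (\<Sum>k<N. (cmod (\<Sum>c<n. cnj (u k c) * v c))\<^sup>2)"
proof -
  have "qform n a v = (\<Sum>r<n. \<Sum>c<n. \<Sum>k<N. (cnj (u k c) * v c) * (u k r * cnj (v r)))"
    unfolding qform_def by (simp add: assms sum_distrib_left sum_distrib_right) (simp add: mult_ac)
  also have "\<dots> = (\<Sum>r<n. \<Sum>k<N. \<Sum>c<n. (cnj (u k c) * v c) * (u k r * cnj (v r)))"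
    by (intro sum.cong refl sum.swap)
  also have "\<dots> = (\<Sum>k<N. \<Sum>r<n. \<Sum>c<n. (cnj (u k c) * v c) * (u k r * cnj (v r)))"
    by (rule sum.swap)
  also have "\<dots> = (\<Sum>k<N. (\<Sum>c<n. cnj (u k c) * v c) * cnj (\<Sum>c<n. cnj (u k c) * v c))"
    by (simp add: sum_distrib_left sum_distrib_right mult_ac)
  also have "\<dots> = of_real (\<Sum>k<N. (cmod (\<Sum>c<n. cnj (u k c) * v c))\<^sup>2)"
    by (simp only: complex_norm_square[symmetric] of_real_sum)
  finally show ?thesis .
qed

text \<open>Cauchy-Schwarz against the all-ones vector; the cross terms in the induction are bounded
  by the sum of the two squares.\<close>

lemma sum_power2_le:
  fixes f :: "nat \<Rightarrow> real"
  shows "(\<Sum>i<m. f i)\<^sup>2 \<le> real m * (\<Sum>i<m. (f i)\<^sup>2)"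
proof (induction m)
  case (Suc m)
  have "2 * (\<Sum>i<m. f i) * f m = (\<Sum>i<m. 2 * f i * f m)"
    by (simp add: sum_distrib_left sum_distrib_right)
  also have "\<dots> \<le> (\<Sum>i<m. (f i)\<^sup>2 + (f m)\<^sup>2)"
    by (intro sum_mono sum_squares_bound)
  finally show ?case
    using Suc by (simp add: sum.distrib power2_sum algebra_simps)
qed simp

lemma cmod_sum_power2_le:
  fixes z :: "nat \<Rightarrow> complex"
  shows "(cmod (\<Sum>i<m. z i))\<^sup>2 \<le> real m * (\<Sum>i<m. (cmod (z i))\<^sup>2)"
proof -
  have "(cmod (\<Sum>i<m. z i))\<^sup>2 \<le> (\<Sum>i<m. cmod (z i))\<^sup>2"
    by (intro power_mono norm_sum) simp
  also have "\<dots> \<le> real m * (\<Sum>i<m. (cmod (z i))\<^sup>2)"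
    by (rule sum_power2_le)
  finally show ?thesis .
qed

definition partial_trace_left :: "nat \<Rightarrow> nat \<Rightarrow> complex mat \<Rightarrow> nat \<Rightarrow> nat \<Rightarrow> complex" where
  "partial_trace_left m n T p q = (\<Sum>a<m. T $$ (a * n + p, a * n + q))"

text \<open>The Kronecker product of the m-dimensional identity with S, where S is a function so
  that a marginal can be inserted directly.\<close>

definition block_diag :: "nat \<Rightarrow> nat \<Rightarrow> (nat \<Rightarrow> nat \<Rightarrow> complex) \<Rightarrow> complex mat" where
  "block_diag m n S = mat (m * n) (m * n)
     (\<lambda>(r, c). if r div n = c div n then S (r mod n) (c mod n) else 0)"

lemma block_diag_carrier [simp]: "block_diag m n S \<in> carrier_mat (m * n) (m * n)"
  by (simp add: block_diag_def)

lemma block_diag_index [simp]: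
  "i < m \<Longrightarrow> j < m \<Longrightarrow> p < n \<Longrightarrow> q < n \<Longrightarrow>
    block_diag m n S $$ (i * n + p, j * n + q) = (if i = j then S p q else 0)"
  by (simp add: block_diag_def)

text \<open>The operator inequality \<open>T \<le> m (I \<otimes> Tr\<^sub>1 T)\<close>, by convexity of the seminorm of \<open>T\<close>.\<close>

lemma psd_mat_block_diag_minus:
  assumes "psd_mat (m * n) T"
  shows "psd_mat (m * n) (of_nat m \<cdot>\<^sub>m block_diag m n (partial_trace_left m n T) - T)"
  unfolding psd_mat_iff
proof (intro conjI allI)
  let ?R = "block_diag m n (partial_trace_left m n T)"
  note T = psd_mat_carrier[OF assms]
  show "of_nat m \<cdot>\<^sub>m ?R - T \<in> carrier_mat (m * n) (m * n)"
    using T by (rule minus_carrier_mat)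
  fix v :: "nat \<Rightarrow> complex"
  obtain u where u: "\<And>r c. r < m * n \<Longrightarrow> c < m * n \<Longrightarrow> T $$ (r, c) = (\<Sum>k<m * n. u k r * cnj (u k c))"
    using psd_mat_gram[OF assms] by blast
  \<comment> \<open>Pairs block a of the k-th Gram vector with block i of v. The form of T involves
    only pairs with a = i, that of the block-diagonal matrix all pairs.\<close>
  define c where "c k a i = (\<Sum>p<n. cnj (u k (a * n + p)) * v (i * n + p))" for k a i
  have qT: "qform (m * n) (\<lambda>r c. T $$ (r, c)) v = of_real (\<Sum>k<m * n. (cmod (\<Sum>i<m. c k i i))\<^sup>2)"
    by (subst qform_gram[where u = u and N = "m * n"]) (simp_all add: u sum_blocks[where m = m and n = n] c_def)
  have block: "qform n (\<lambda>p q. T $$ (a * n + p, a * n + q)) (\<lambda>p. v (i * n + p)) =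
      of_real (\<Sum>k<m * n. (cmod (c k a i))\<^sup>2)" if "a < m" for a i
    unfolding c_def by (rule qform_gram) (use that in \<open>simp add: u\<close>)
  have "qform (m * n) (\<lambda>r c. ?R $$ (r, c)) v =
      (\<Sum>i<m. \<Sum>p<n. \<Sum>j<m. \<Sum>q<n. if i = j then partial_trace_left m n T p q * v (j * n + q) * cnj (v (i * n + p)) else 0)"
    unfolding qform_def sum_blocks[where m = m and n = n] by (intro sum.cong refl) simp
  also have "\<dots> =
      (\<Sum>i<m. \<Sum>p<n. \<Sum>q<n. \<Sum>j<m. if i = j then partial_trace_left m n T p q * v (j * n + q) * cnj (v (i * n + p)) else 0)"
    by (intro sum.cong refl sum.swap)
  also have "\<dots> = (\<Sum>i<m. \<Sum>p<n. \<Sum>q<n. \<Sum>a<m. T $$ (a * n + p, a * n + q) * v (i * n + q) * cnj (v (i * n + p)))"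
    by (simp add: partial_trace_left_def sum_distrib_right)
  also have "\<dots> = (\<Sum>i<m. \<Sum>p<n. \<Sum>a<m. \<Sum>q<n. T $$ (a * n + p, a * n + q) * v (i * n + q) * cnj (v (i * n + p)))"
    by (intro sum.cong refl sum.swap)
  also have "\<dots> = (\<Sum>i<m. \<Sum>a<m. qform n (\<lambda>p q. T $$ (a * n + p, a * n + q)) (\<lambda>p. v (i * n + p)))"
    unfolding qform_def by (intro sum.cong refl sum.swap)
  finally have qR: "qform (m * n) (\<lambda>r c. ?R $$ (r, c)) v =
      of_real (\<Sum>i<m. \<Sum>a<m. \<Sum>k<m * n. (cmod (c k a i))\<^sup>2)"
    by (simp add: block)
  have "qform (m * n) (\<lambda>r c. (of_nat m \<cdot>\<^sub>m ?R - T) $$ (r, c)) v =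
      of_nat m * qform (m * n) (\<lambda>r c. ?R $$ (r, c)) v - qform (m * n) (\<lambda>r c. T $$ (r, c)) v"
    using T
    by (simp add: carrier_matD[OF block_diag_carrier] qform_def sum_distrib_left sum_subtractf[symmetric] algebra_simps)
  also have "\<dots> = of_real (real m * (\<Sum>i<m. \<Sum>a<m. \<Sum>k<m * n. (cmod (c k a i))\<^sup>2)
      - (\<Sum>k<m * n. (cmod (\<Sum>i<m. c k i i))\<^sup>2))"
    by (simp add: qR qT)
  finally have eq: "qform (m * n) (\<lambda>r c. (of_nat m \<cdot>\<^sub>m ?R - T) $$ (r, c)) v = \<dots>" .
  \<comment> \<open>Cauchy-Schwarz over the m blocks is the source of the factor m.\<close>
  have "(\<Sum>k<m * n. (cmod (\<Sum>i<m. c k i i))\<^sup>2) \<le> (\<Sum>k<m * n. real m * (\<Sum>i<m. (cmod (c k i i))\<^sup>2))"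
    by (intro sum_mono cmod_sum_power2_le)
  also have "\<dots> = real m * (\<Sum>i<m. \<Sum>k<m * n. (cmod (c k i i))\<^sup>2)"
    unfolding sum_distrib_left[symmetric] by (subst sum.swap) simp
  \<comment> \<open>The diagonal pairs (i, i) are among all pairs (a, i), and every term is
    nonnegative.\<close>
  also have "\<dots> \<le> real m * (\<Sum>i<m. \<Sum>a<m. \<Sum>k<m * n. (cmod (c k a i))\<^sup>2)"
    by (intro mult_left_mono sum_mono) (auto intro!: member_le_sum[where f = "\<lambda>a. \<Sum>k<m * n. (cmod (c k a _))\<^sup>2"] sum_nonneg)
  finally show "0 \<le> qform (m * n) (\<lambda>r c. (of_nat m \<cdot>\<^sub>m ?R - T) $$ (r, c)) v"
    unfolding eq by (simp add: nonneg_complex_iff)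
qed

section \<open>Success sums under a complete measurement\<close>

lemma povm_sum_index:
  assumes "povm n Z M" "r < n" "c < n"
  shows "(\<Sum>z\<in>Z. M z $$ (r, c)) = (if r = c then 1 else 0)"
proof -
  have "mat n n (\<lambda>ij. \<Sum>z\<in>Z. M z $$ ij) $$ (r, c) = 1\<^sub>m n $$ (r, c)"
    using assms by (simp add: povm_def)
  then show ?thesis using assms by simp
qed

lemma povm_mtrace_sum:
  assumes "povm n Z M" "R \<in> carrier_mat n n"
  shows "(\<Sum>z\<in>Z. mtrace (M z * R)) = mtrace R"
proof -
  have "M z \<in> carrier_mat n n" if "z \<in> Z" for z
    using assms that by (simp add: povm_def psd_mat_def)
  then have "(\<Sum>z\<in>Z. mtrace (M z * R)) = (\<Sum>z\<in>Z. \<Sum>r<n. \<Sum>c<n. M z $$ (r, c) * R $$ (c, r))"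
    by (intro sum.cong refl mtrace_times assms)
  also have "\<dots> = (\<Sum>r<n. \<Sum>z\<in>Z. \<Sum>c<n. M z $$ (r, c) * R $$ (c, r))" by (rule sum.swap)
  also have "\<dots> = (\<Sum>r<n. \<Sum>c<n. (\<Sum>z\<in>Z. M z $$ (r, c)) * R $$ (c, r))"
    unfolding sum_distrib_right by (intro sum.cong refl sum.swap)
  also have "\<dots> = (\<Sum>r<n. \<Sum>c<n. if r = c then R $$ (c, r) else 0)"
    by (intro sum.cong refl) (simp add: povm_sum_index[OF assms(1)])
  finally show ?thesis using assms(2) by (simp add: mtrace_def)
qed

text \<open>For fixed y each outcome is correct for exactly one x. The success terms are dominated
  by traces of the measurement operators against one common matrix R, and completeness of the
  measurement sums these to the trace of R.\<close>

lemma QE_sum_le: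
  assumes Q: "Q \<in> QE X Y Z d1 d2" and y: "y \<in> Y" and f: "bij_betw (\<lambda>x. f x y) X Z"
  shows "(\<Sum>x\<in>X. Q (f x y) x y) \<le> real (d1\<^sup>2)"
proof (cases "X = {}")
  case False
  then obtain x0 where x0: "x0 \<in> X" by blast
  from Q obtain dA dB \<rho> E F M where
    Q: "Q = network_dist dA dB d1 d2 \<rho> E F M" and \<rho>: "density_mat (dA * dB) \<rho>"
    and E: "\<And>x. x \<in> X \<Longrightarrow> quantum_channel dA d1 (E x)"
    and F: "quantum_channel dB d2 (F y)" and M: "povm (d1 * d2) Z M"
    unfolding QE_def using y by blast
  define T where "T x = tensor_map dA dB d1 d2 (E x) (F y) \<rho>" for x
  define R where "R = block_diag d1 d2 (partial_trace_left d1 d2 (T x0))"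
  \<comment> \<open>By no-signalling the same R serves every x, although it is defined from
    \<open>x0\<close>.\<close>
  have R: "R = block_diag d1 d2 (partial_trace_left d1 d2 (T x))" if "x \<in> X" for x
    unfolding R_def
    by (rule eq_mat_blocksI[where m = d1 and n = d2])
      (auto simp: partial_trace_left_def T_def partial_trace_tensor_map[OF E sized_map_channel[OF F]] x0 that)
  have R_carrier: "R \<in> carrier_mat (d1 * d2) (d1 * d2)" by (simp add: R_def)
  have T: "psd_mat (d1 * d2) (T x)" if "x \<in> X" for x
    unfolding T_def using \<rho> by (intro psd_mat_tensor_map E F that) (simp add: density_mat_def)
  have le: "Re (mtrace (M z * T x)) \<le> d1 * Re (mtrace (M z * R))" if "x \<in> X" "z \<in> Z" for x z
  proof -
    have Mz: "psd_mat (d1 * d2) (M z)" using M that by (simp add: povm_def)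
    have "0 \<le> mtrace (M z * (of_nat d1 \<cdot>\<^sub>m R - T x))"
      by (rule mtrace_times_psd[OF Mz]) (use psd_mat_block_diag_minus[OF T] that R in metis)
    also have "\<dots> = of_nat d1 * mtrace (M z * R) - mtrace (M z * T x)"
    proof -
      note c = psd_mat_carrier[OF Mz] psd_mat_carrier[OF T[OF that(1)]]
      have "of_nat d1 \<cdot>\<^sub>m R - T x \<in> carrier_mat (d1 * d2) (d1 * d2)"
        using c(2) by (rule minus_carrier_mat)
      then show ?thesis
        unfolding mtrace_times[OF c] mtrace_times[OF c(1) R_carrier] mtrace_times[OF c(1) \<open>_ - _ \<in> _\<close>]
        using R_carrier c(2) by (simp add: sum_distrib_left sum_subtractf[symmetric] algebra_simps)
    qed
    finally show ?thesis by (simp add: nonneg_complex_iff)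
  qed
  \<comment> \<open>One factor \<open>d1\<close> of the bound is the trace of the identity on the
    first system; the other comes from the operator inequality used in \<open>le\<close>.\<close>
  have "mtrace R = of_nat d1 * (\<Sum>p<d2. partial_trace_left d1 d2 (T x0) p p)"
    unfolding R_def mtrace_blocks[OF block_diag_carrier] by (simp add: sum_distrib_left)
  also have "(\<Sum>p<d2. partial_trace_left d1 d2 (T x0) p p) = mtrace (T x0)"
    using psd_mat_carrier[OF T[OF x0]] by (simp add: mtrace_blocks partial_trace_left_def)
  also have "mtrace (T x0) = 1"
    unfolding T_def using \<rho> by (subst mtrace_tensor_map[OF E[OF x0] F]) (auto simp: density_mat_def psd_mat_def)
  finally have trR: "mtrace R = of_nat d1" by simp
  have "(\<Sum>x\<in>X. Q (f x y) x y) = (\<Sum>x\<in>X. Re (mtrace (M (f x y) * T x)))"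
    by (simp add: Q network_dist_def T_def)
  also have "\<dots> \<le> (\<Sum>x\<in>X. d1 * Re (mtrace (M (f x y) * R)))"
    using f by (intro sum_mono le) (auto simp: bij_betw_def)
  also have "\<dots> = d1 * Re (\<Sum>z\<in>Z. mtrace (M z * R))"
    by (simp add: sum_distrib_left sum.reindex_bij_betw[OF f, of "\<lambda>z. d1 * Re (mtrace (M z * R))"])
  also have "\<dots> = real (d1\<^sup>2)"
    by (simp add: povm_mtrace_sum[OF M R_carrier] trR power2_eq_square)
  finally show ?thesis .
qed simp

text \<open>Reversing the tensor factors exchanges the senders, so that a bound in \<open>d1\<close>
  also gives one in \<open>d2\<close>. Agreement is claimed for z in Z, where \<open>M z\<close> is
  known to have the right size.\<close>

lemma QE_swap:
  assumes "Q \<in> QE X Y Z d1 d2"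
  obtains Q' where "Q' \<in> QE Y X Z d2 d1" "\<And>x y z. x \<in> X \<Longrightarrow> y \<in> Y \<Longrightarrow> z \<in> Z \<Longrightarrow> Q' z y x = Q z x y"
proof -
  from assms obtain dA dB \<rho> E F M where
    Q: "Q = network_dist dA dB d1 d2 \<rho> E F M" and \<rho>: "density_mat (dA * dB) \<rho>"
    and E: "\<forall>x\<in>X. quantum_channel dA d1 (E x)"
    and F: "\<forall>y\<in>Y. quantum_channel dB d2 (F y)" and M: "povm (d1 * d2) Z M"
    unfolding QE_def by blast
  have Mc: "M z \<in> carrier_mat (d1 * d2) (d1 * d2)" if "z \<in> Z" for z
    using M that by (simp add: povm_def psd_mat_def)
  let ?Q = "network_dist dB dA d2 d1 (swap_mat dA dB \<rho>) F E (\<lambda>z. swap_mat d1 d2 (M z))"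
  have "density_mat (dB * dA) (swap_mat dA dB \<rho>)"
    using \<rho> by (auto simp: density_mat_def psd_mat_swap mtrace_swap psd_mat_carrier)
  moreover have "povm (d2 * d1) Z (\<lambda>z. swap_mat d1 d2 (M z))"
    unfolding povm_def
  proof (intro conjI ballI)
    show "mat (d2 * d1) (d2 * d1) (\<lambda>ij. \<Sum>z\<in>Z. swap_mat d1 d2 (M z) $$ ij) = 1\<^sub>m (d2 * d1)"
    proof (rule eq_mat_blocksI)
      fix i j p q assume *: "i < d2" "j < d2" "p < d1" "q < d1"
      have inj: "a * n + b = a' * n + b' \<longleftrightarrow> a = a' \<and> b = b'" if "b < n" "b' < n" for a b a' b' n :: nat
        using block_index[OF that(1), of a] block_index[OF that(2), of a'] by metis
      show "mat (d2 * d1) (d2 * d1) (\<lambda>ij. \<Sum>z\<in>Z. swap_mat d1 d2 (M z) $$ ij) $$ (i * d1 + p, j * d1 + q) =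
          1\<^sub>m (d2 * d1) $$ (i * d1 + p, j * d1 + q)"
        using * by (auto simp: povm_sum_index[OF M] inj)
    qed auto
  qed (use M in \<open>auto simp: povm_def psd_mat_swap\<close>)
  ultimately have "?Q \<in> QE Y X Z d2 d1"
    unfolding QE_def using E F by blast
  moreover have "?Q z y x = Q z x y" if "x \<in> X" "y \<in> Y" "z \<in> Z" for x y z
  proof -
    have "sized_map dA d1 (E x)" "sized_map dB d2 (F y)"
      using E F that by (auto intro: sized_map_channel)
    then show ?thesis
      unfolding Q network_dist_def by (simp add: tensor_map_swap mtrace_swap_times Mc that)
  qed
  ultimately show thesis by (rule that)
qed

text \<open>With either input fixed, the product is a bijection in the other one. Hence the sum over
  all pairs is at most the group order times the square of either dimension, and the normalization
  divides by the squared order.\<close>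

lemma (in group) success_prob_le:
  assumes fin: "finite (carrier G)" and Q: "Q \<in> QE (carrier G) (carrier G) (carrier G) d1 d2"
  shows "success_prob (carrier G) (carrier G) (\<lambda>g h. g \<otimes> h) Q \<le> real ((min d1 d2)\<^sup>2) / real (card (carrier G))"
proof -
  let ?X = "carrier G"
  have bij: "bij_betw (\<lambda>g. g \<otimes> h) ?X ?X" "bij_betw (\<lambda>g. h \<otimes> g) ?X ?X" if "h \<in> ?X" for h
    by (rule bij_betw_byWitness[where f' = "\<lambda>g. g \<otimes> inv h"], use that in \<open>auto simp: m_assoc\<close>)
      (rule bij_betw_byWitness[where f' = "\<lambda>g. inv h \<otimes> g"], use that in \<open>auto simp: m_assoc[symmetric]\<close>)
  have "(\<Sum>g\<in>?X. \<Sum>h\<in>?X. Q (g \<otimes> h) g h) = (\<Sum>h\<in>?X. \<Sum>g\<in>?X. Q (g \<otimes> h) g h)"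
    by (rule sum.swap)
  also have "\<dots> \<le> (\<Sum>h\<in>?X. real (d1\<^sup>2))"
    by (intro sum_mono QE_sum_le[OF Q] bij)
  finally have 1: "(\<Sum>g\<in>?X. \<Sum>h\<in>?X. Q (g \<otimes> h) g h) \<le> card ?X * real (d1\<^sup>2)" by simp
  obtain Q' where Q': "Q' \<in> QE ?X ?X ?X d2 d1"
    "\<And>x y z. x \<in> ?X \<Longrightarrow> y \<in> ?X \<Longrightarrow> z \<in> ?X \<Longrightarrow> Q' z y x = Q z x y"
    using QE_swap[OF Q] by blast
  have "(\<Sum>g\<in>?X. \<Sum>h\<in>?X. Q (g \<otimes> h) g h) = (\<Sum>g\<in>?X. \<Sum>h\<in>?X. Q' (g \<otimes> h) h g)"
    by (intro sum.cong refl) (simp add: Q'(2))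
  also have "\<dots> \<le> (\<Sum>h\<in>?X. real (d2\<^sup>2))"
    using QE_sum_le[OF Q'(1), where f = "\<lambda>h g. g \<otimes> h"] bij by (intro sum_mono) auto
  finally have 2: "(\<Sum>g\<in>?X. \<Sum>h\<in>?X. Q (g \<otimes> h) g h) \<le> card ?X * real (d2\<^sup>2)" by simp
  have pos: "card ?X > 0" using fin one_closed by (auto simp: card_gt_0_iff)
  have "(\<Sum>g\<in>?X. \<Sum>h\<in>?X. Q (g \<otimes> h) g h) \<le> card ?X * real ((min d1 d2)\<^sup>2)"
    using 1 2 by (auto simp: min_def)
  then show ?thesis
    using pos by (simp add: success_prob_def field_simps)
qed

subsection \<open>The dense network coding protocol\<close>

lemma conj_map_index:
  assumes "K \<in> carrier_mat m n" "X \<in> carrier_mat n n" "a < m" "b < m"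
  shows "conj_map K X $$ (a, b) = (\<Sum>r<n. \<Sum>c<n. K $$ (a, r) * X $$ (r, c) * cnj (K $$ (b, c)))"
proof -
  have "conj_map K X $$ (a, b) = (\<Sum>c<n. \<Sum>r<n. K $$ (a, r) * X $$ (r, c) * cnj (K $$ (b, c)))"
    unfolding conj_map_def
    by (subst times_mat_index_sum[where m = m and n = n and k = m])
      (use assms in \<open>auto simp: times_mat_index_sum[where m = m and n = n and k = n] sum_distrib_right
        simp del: index_mult_mat(1)\<close>)
  then show ?thesis by (subst sum.swap)
qed

lemma conj_map_carrier [simp]:
  "K \<in> carrier_mat m n \<Longrightarrow> conj_map K X \<in> carrier_mat m m"
  by (auto simp: conj_map_def)

lemma sized_map_conj_map: "K \<in> carrier_mat m n \<Longrightarrow> sized_map n m (conj_map K)"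
  by (simp add: sized_map_def)

lemma conj_map_elem_mat_index:
  assumes "K \<in> carrier_mat m n" "i < n" "j < n" "a < m" "b < m"
  shows "conj_map K (elem_mat n i j) $$ (a, b) = K $$ (a, i) * cnj (K $$ (b, j))"
proof -
  have "conj_map K (elem_mat n i j) $$ (a, b) =
      (\<Sum>r<n. \<Sum>c<n. if i = r \<and> j = c then K $$ (a, r) * cnj (K $$ (b, c)) else 0)"
    unfolding conj_map_index[OF assms(1) elem_mat_carrier assms(4,5)]
    by (intro sum.cong refl) (simp add: elem_mat_index)
  also have "\<dots> = K $$ (a, i) * cnj (K $$ (b, j))"
    by (rule sum_delta2) fact+
  finally show ?thesis .
qed

lemma conj_map_one:
  assumes "A \<in> carrier_mat n n"
  shows "conj_map (1\<^sub>m n) A = A"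
proof -
  have "mat_adjoint (1\<^sub>m n) = (1\<^sub>m n :: complex mat)"
    by (rule eq_matI) auto
  then show ?thesis using assms by (simp add: conj_map_def)
qed

text \<open>Conjugation sends an elementary matrix to products of one entry and one conjugated
  entry; the factors from V and W regroup into entries of \<open>kron V W\<close>.\<close>

lemma tensor_map_conj_map:
  assumes "V \<in> carrier_mat n1 m1" "W \<in> carrier_mat n2 m2" "\<rho> \<in> carrier_mat (m1 * m2) (m1 * m2)"
  shows "tensor_map m1 m2 n1 n2 (conj_map V) (conj_map W) \<rho> = conj_map (kron V W) \<rho>"
proof (rule eq_mat_blocksI)
  note VW = kron_carrier[OF assms(1,2)]
  show "conj_map (kron V W) \<rho> \<in> carrier_mat (n1 * n2) (n1 * n2)"
    using VW by (rule conj_map_carrier)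
  fix a b p q assume *: "a < n1" "b < n1" "p < n2" "q < n2"
  have "tensor_map m1 m2 n1 n2 (conj_map V) (conj_map W) \<rho> $$ (a * n2 + p, b * n2 + q) =
      (\<Sum>i<m1. \<Sum>j<m1. \<Sum>k<m2. \<Sum>l<m2. kron V W $$ (a * n2 + p, i * m2 + k) * \<rho> $$ (i * m2 + k, j * m2 + l)
        * cnj (kron V W $$ (b * n2 + q, j * m2 + l)))"
    unfolding tensor_map_index[OF sized_map_conj_map[OF assms(1)] sized_map_conj_map[OF assms(2)] *]
    by (intro sum.cong refl)
      (simp add: conj_map_elem_mat_index[OF assms(1)] conj_map_elem_mat_index[OF assms(2)]
        kron_index[OF assms(1,2)] *)
  also have "\<dots> = (\<Sum>i<m1. \<Sum>k<m2. \<Sum>j<m1. \<Sum>l<m2. kron V W $$ (a * n2 + p, i * m2 + k) * \<rho> $$ (i * m2 + k, j * m2 + l)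
        * cnj (kron V W $$ (b * n2 + q, j * m2 + l)))"
    by (intro sum.cong refl sum.swap)
  also have "\<dots> = conj_map (kron V W) \<rho> $$ (a * n2 + p, b * n2 + q)"
    unfolding conj_map_index[OF VW assms(3) block_index_less[OF *(1,3)] block_index_less[OF *(2,4)]]
    by (simp only: sum_blocks)
  finally show "tensor_map m1 m2 n1 n2 (conj_map V) (conj_map W) \<rho> $$ (a * n2 + p, b * n2 + q) =
      conj_map (kron V W) \<rho> $$ (a * n2 + p, b * n2 + q)" .
qed simp

text \<open>Serves to replace the identity map by conjugation with an identity matrix, which agrees
  with it only on matrices of the right size.\<close>

lemma tensor_map_cong:
  assumes "\<And>i j. i < m1 \<Longrightarrow> j < m1 \<Longrightarrow> E (elem_mat m1 i j) = E' (elem_mat m1 i j)"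
    and "\<And>k l. k < m2 \<Longrightarrow> l < m2 \<Longrightarrow> F (elem_mat m2 k l) = F' (elem_mat m2 k l)"
  shows "tensor_map m1 m2 n1 n2 E F \<rho> = tensor_map m1 m2 n1 n2 E' F' \<rho>"
  unfolding tensor_map_def using assms by (auto intro!: sum.cong)

text \<open>A channel with a single Kraus operator. Adjoining an ancilla gives conjugation by
  \<open>kron (1\<^sub>m k) K\<close>, hence complete positivity; cyclicity of the trace and the
  isometry condition give trace preservation.\<close>

lemma quantum_channel_conj_map:
  assumes K: "K \<in> carrier_mat m n" and iso: "mat_adjoint K * K = 1\<^sub>m n"
  shows "quantum_channel n m (conj_map K)"
  unfolding quantum_channel_def
proof (intro conjI ballI)
  show "linear_mat_map n m (conj_map K)"
    unfolding linear_mat_map_def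
  proof (intro conjI ballI allI)
    fix A B :: "complex mat" assume AB: "A \<in> carrier_mat n n" "B \<in> carrier_mat n n"
    have "K * (A + B) = K * A + K * B" using K AB by (rule mult_add_distrib_mat)
    moreover have "(K * A + K * B) * mat_adjoint K = K * A * mat_adjoint K + K * B * mat_adjoint K"
      by (rule add_mult_distrib_mat) (use K AB in auto)
    ultimately show "conj_map K (A + B) = conj_map K A + conj_map K B"
      by (simp add: conj_map_def)
  next
    fix c and A :: "complex mat" assume A: "A \<in> carrier_mat n n"
    show "conj_map K (c \<cdot>\<^sub>m A) = c \<cdot>\<^sub>m conj_map K A"
      using K A by (simp add: conj_map_def mult_smult_distrib mult_smult_assoc_mat[of "K * A" m n _ m])
  qed (use K in simp)
  show "completely_positive n m (conj_map K)"
    unfolding completely_positive_def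
  proof (intro allI impI)
    fix k X assume X: "psd_mat (k * n) X"
    have "tensor_map k n k m (\<lambda>A. A) (conj_map K) X = tensor_map k n k m (conj_map (1\<^sub>m k)) (conj_map K) X"
      by (rule tensor_map_cong) (simp_all add: conj_map_one)
    also have "\<dots> = conj_map (kron (1\<^sub>m k) K) X"
      by (rule tensor_map_conj_map) (use K psd_mat_carrier[OF X] in auto)
    finally show "psd_mat (k * m) (tensor_map k n k m (\<lambda>A. A) (conj_map K) X)"
      unfolding conj_map_def using psd_mat_conj[OF X] K by simp
  qed
  fix A :: "complex mat" assume "A \<in> carrier_mat n n"
  then show "mtrace (conj_map K A) = mtrace A"
    unfolding conj_map_def by (simp add: mtrace_conj_map[OF K] iso)
qed

section \<open>Pure states and their projections\<close>

lemma rank1_proj_carrier [simp]: "v \<in> carrier_vec n \<Longrightarrow> rank1_proj v \<in> carrier_mat n n"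
  by (auto simp: rank1_proj_def)

lemma psd_mat_rank1_proj:
  assumes "v \<in> carrier_vec n"
  shows "psd_mat n (rank1_proj v)"
  unfolding psd_mat_iff
proof (intro conjI allI)
  fix w :: "nat \<Rightarrow> complex"
  have "qform n (\<lambda>r c. rank1_proj v $$ (r, c)) w = (\<Sum>r<n. \<Sum>c<n. (v $ r * cnj (w r)) * (cnj (v $ c) * w c))"
    using assms by (simp add: qform_def rank1_proj_def) (simp add: mult_ac)
  also have "\<dots> = (\<Sum>r<n. v $ r * cnj (w r)) * cnj (\<Sum>r<n. v $ r * cnj (w r))"
    by (simp add: sum_product)
  finally show "0 \<le> qform n (\<lambda>r c. rank1_proj v $$ (r, c)) w"
    by (simp only: mult_cnj_nonneg)
qed (use assms in simp)

lemma mtrace_rank1_proj: "mtrace (rank1_proj v) = v \<bullet>c v"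
  by (simp add: mtrace_def rank1_proj_def scalar_prod_def atLeast0LessThan)

lemma density_mat_rank1_proj:
  "v \<in> carrier_vec n \<Longrightarrow> v \<bullet>c v = 1 \<Longrightarrow> density_mat n (rank1_proj v)"
  by (simp add: density_mat_def psd_mat_rank1_proj mtrace_rank1_proj)

lemma mtrace_rank1_proj_times:
  assumes "v \<in> carrier_vec n" "w \<in> carrier_vec n"
  shows "mtrace (rank1_proj v * rank1_proj w) = (v \<bullet>c w) * (w \<bullet>c v)"
proof -
  have "mtrace (rank1_proj v * rank1_proj w) = (\<Sum>r<n. \<Sum>c<n. (v $ r * cnj (w $ r)) * (w $ c * cnj (v $ c)))"
    using assms by (simp add: mtrace_times[of _ n n] rank1_proj_def) (simp add: mult_ac)
  then show ?thesis
    using assms by (simp add: sum_product scalar_prod_def atLeast0LessThan)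
qed

lemma conj_map_rank1_proj:
  assumes "K \<in> carrier_mat m n" "v \<in> carrier_vec n"
  shows "conj_map K (rank1_proj v) = rank1_proj (K *\<^sub>v v)"
proof (rule eq_matI)
  fix a b assume "a < dim_row (rank1_proj (K *\<^sub>v v))" "b < dim_col (rank1_proj (K *\<^sub>v v))"
  then have ab: "a < m" "b < m" using assms by (auto simp: rank1_proj_def)
  have "conj_map K (rank1_proj v) $$ (a, b) =
      (\<Sum>r<n. \<Sum>c<n. (K $$ (a, r) * v $ r) * cnj (K $$ (b, c) * v $ c))"
    using assms ab by (simp add: conj_map_index[of K m n] rank1_proj_def) (simp add: mult_ac)
  also have "\<dots> = (\<Sum>r<n. K $$ (a, r) * v $ r) * cnj (\<Sum>c<n. K $$ (b, c) * v $ c)"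
    by (simp add: sum_product)
  finally show "conj_map K (rank1_proj v) $$ (a, b) = rank1_proj (K *\<^sub>v v) $$ (a, b)"
    using assms ab by (simp add: rank1_proj_def scalar_prod_def atLeast0LessThan)
qed (use assms in \<open>auto simp: rank1_proj_def conj_map_def\<close>)

text \<open>A global phase cancels against its conjugate, which makes the factor \<omega> invisible
  to the receiver.\<close>

lemma rank1_proj_smult:
  assumes "cmod c = 1"
  shows "rank1_proj (c \<cdot>\<^sub>v v) = rank1_proj v"
proof -
  have "c * cnj c = 1" using assms by (simp add: complex_norm_square[symmetric])
  then have "c * x * cnj (c * y) = x * cnj y" for x y
    by (metis (no_types, opaque_lifting) complex_cnj_mult mult.assoc mult.left_commute mult_1)
  then show ?thesis by (intro eq_matI) (auto simp: rank1_proj_def)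
qed

section \<open>The maximally entangled state and the measurement basis\<close>

lemma max_ent_carrier [simp]: "max_ent d \<in> carrier_vec (d * d)"
  by (simp add: max_ent_def)

text \<open>The transpose trick in coordinates: reshaped into a d by d array, the state becomes a
  multiple of the identity, V multiplies it from the left, and W on the second half multiplies by
  its transpose from the right.\<close>

lemma kron_max_ent:
  assumes "V \<in> carrier_mat d d" "W \<in> carrier_mat d d"
  shows "kron V W *\<^sub>v max_ent d =
    vec (d * d) (\<lambda>r. (V * transpose_mat W) $$ (r div d, r mod d) / complex_of_real (sqrt (real d)))"
proof (rule eq_vecI)
  fix r assume "r < dim_vec (vec (d * d) (\<lambda>r. (V * transpose_mat W) $$ (r div d, r mod d) / complex_of_real (sqrt (real d))))"
  then have "r < d * d" by simp
  then obtain a p where r: "a < d" "p < d" "r = a * d + p" by (rule block_index_cases)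
  have "(kron V W *\<^sub>v max_ent d) $ r = (\<Sum>i<d. \<Sum>k<d. kron V W $$ (a * d + p, i * d + k) * max_ent d $ (i * d + k))"
    using kron_carrier[OF assms] \<open>r < d * d\<close>
    by (simp add: carrier_vecD[OF max_ent_carrier] scalar_prod_def atLeast0LessThan sum_blocks r(3))
  also have "\<dots> = (\<Sum>i<d. \<Sum>k<d. if i = k then V $$ (a, i) * W $$ (p, k) / complex_of_real (sqrt (real d)) else 0)"
    by (intro sum.cong refl) (simp add: kron_index[OF assms] r max_ent_def)
  also have "\<dots> = (V * transpose_mat W) $$ (a, p) / complex_of_real (sqrt (real d))"
    using assms r by (simp add: scalar_prod_def atLeast0LessThan sum_divide_distrib)
  finally show "(kron V W *\<^sub>v max_ent d) $ r = vec (d * d) (\<lambda>r. (V * transpose_mat W) $$ (r div d, r mod d) / complex_of_real (sqrt (real d))) $ r"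
    using r by simp
qed (use kron_carrier[OF assms] in auto)

text \<open>The inner product becomes the normalized Hilbert-Schmidt product, so trace orthogonality
  of a representation is orthonormality of the measurement basis.\<close>

lemma max_ent_inner:
  assumes "V \<in> carrier_mat d d" "W \<in> carrier_mat d d"
  shows "(kron W (1\<^sub>m d) *\<^sub>v max_ent d) \<bullet>c (kron V (1\<^sub>m d) *\<^sub>v max_ent d) = mtrace (mat_adjoint V * W) / of_nat d"
proof -
  have "(kron W (1\<^sub>m d) *\<^sub>v max_ent d) \<bullet>c (kron V (1\<^sub>m d) *\<^sub>v max_ent d) =
     (\<Sum>a<d. \<Sum>p<d. W $$ (a, p) / complex_of_real (sqrt (real d)) * cnj (V $$ (a, p) / complex_of_real (sqrt (real d))))"
    using assms by (simp add: kron_max_ent scalar_prod_def atLeast0LessThan sum_blocks del: complex_cnj_divide)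
  also have "\<dots> = (\<Sum>a<d. \<Sum>p<d. cnj (V $$ (a, p)) * W $$ (a, p) / of_nat d)"
    by (intro sum.cong refl) (simp flip: of_real_mult)
  also have "\<dots> = mtrace (mat_adjoint V * W) / of_nat d"
    using assms by (subst mtrace_times[of _ d d]) (auto simp: sum_divide_distrib intro: sum.swap)
  finally show ?thesis .
qed

text \<open>The vectors form the columns of a square matrix A. Orthonormality says that
  \<open>mat_adjoint A\<close> is a left inverse; being also a right inverse is the completeness
  relation.\<close>

lemma povm_orthonormal_basis:
  assumes "finite Z" "card Z = n" and v: "\<And>z. z \<in> Z \<Longrightarrow> v z \<in> carrier_vec n"
    and orth: "\<And>z w. z \<in> Z \<Longrightarrow> w \<in> Z \<Longrightarrow> v z \<bullet>c v w = (if z = w then 1 else 0)"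
  shows "povm n Z (\<lambda>z. rank1_proj (v z))"
  unfolding povm_def
proof (intro conjI ballI)
  obtain e where e: "bij_betw e {..<n} Z"
    using ex_bij_betw_nat_finite[OF assms(1)] assms(2) by (auto simp: atLeast0LessThan)
  then have eZ: "e k \<in> Z" if "k < n" for k using that by (auto simp: bij_betw_def)
  have e_eq: "e k = e l \<longleftrightarrow> k = l" if "k < n" "l < n" for k l
    using e that by (auto simp: bij_betw_def inj_on_def)
  define A where "A = mat n n (\<lambda>(r, k). v (e k) $ r)"
  have A: "A \<in> carrier_mat n n" by (simp add: A_def)
  have "mat_adjoint A * A = 1\<^sub>m n"
  proof (rule eq_matI)
    fix k l assume "k < dim_row (1\<^sub>m n :: complex mat)" "l < dim_col (1\<^sub>m n :: complex mat)"
    then have kl: "k < n" "l < n" by auto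
    have "(mat_adjoint A * A) $$ (k, l) = (\<Sum>r<n. cnj (v (e k) $ r) * v (e l) $ r)"
      using A kl by (subst times_mat_index_sum[of _ n n _ n]) (auto simp: A_def)
    also have "\<dots> = v (e l) \<bullet>c v (e k)"
      using v[OF eZ[OF kl(1)]] by (simp add: scalar_prod_def atLeast0LessThan mult.commute)
    finally show "(mat_adjoint A * A) $$ (k, l) = 1\<^sub>m n $$ (k, l)"
      using kl orth[OF eZ eZ] e_eq by auto
  qed (use A in auto)
  then have AA: "A * mat_adjoint A = 1\<^sub>m n"
    by (rule mat_mult_left_right_inverse[rotated 2]) (use A in auto)
  show "mat n n (\<lambda>ij. \<Sum>z\<in>Z. rank1_proj (v z) $$ ij) = 1\<^sub>m n"
    unfolding AA[symmetric]
  proof (rule eq_matI)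
    fix r c assume "r < dim_row (A * mat_adjoint A)" "c < dim_col (A * mat_adjoint A)"
    then have rc: "r < n" "c < n" using A by auto
    have "(\<Sum>z\<in>Z. rank1_proj (v z) $$ (r, c)) = (\<Sum>z\<in>Z. v z $ r * cnj (v z $ c))"
      using v rc by (intro sum.cong refl) (simp add: rank1_proj_def carrier_vecD[OF v])
    also have "\<dots> = (\<Sum>k<n. v (e k) $ r * cnj (v (e k) $ c))"
      by (rule sum.reindex_bij_betw[OF e, symmetric])
    also have "\<dots> = (A * mat_adjoint A) $$ (r, c)"
      using A rc by (subst times_mat_index_sum[of _ n n _ n]) (auto simp: A_def)
    finally show "mat n n (\<lambda>ij. \<Sum>z\<in>Z. rank1_proj (v z) $$ ij) $$ (r, c) = (A * mat_adjoint A) $$ (r, c)"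
      using rc by simp
  qed (use A in auto)
qed (use assms in \<open>auto intro: psd_mat_rank1_proj\<close>)

lemma unitary_mat_transpose:
  assumes "unitary_mat n U"
  shows "unitary_mat n (transpose_mat U)"
proof -
  have U: "U \<in> carrier_mat n n" using assms by (simp add: unitary_mat_def)
  have adj: "mat_adjoint (transpose_mat U) = transpose_mat (mat_adjoint U)"
    using U by (intro eq_matI) auto
  have "transpose_mat (mat_adjoint U) * transpose_mat U = transpose_mat (U * mat_adjoint U)"
    by (rule transpose_mult[symmetric]) (use U in auto)
  moreover have "transpose_mat U * transpose_mat (mat_adjoint U) = transpose_mat (mat_adjoint U * U)"
    by (rule transpose_mult[symmetric]) (use U in auto)
  ultimately show ?thesis
    using assms U by (simp add: unitary_mat_def adj)
qed

lemma quantum_channel_unitary: "unitary_mat n U \<Longrightarrow> quantum_channel n n (conj_map U)"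
  by (rule quantum_channel_conj_map) (simp_all add: unitary_mat_def)

text \<open>Bounding a supremum of reals from above requires a nonempty set. The witness always
  announces \<open>z0\<close>, and positive dimensions make room for the unit vector used as shared
  state.\<close>

lemma QE_nonempty:
  assumes "finite Z" "z0 \<in> Z" "0 < d1" "0 < d2"
  shows "QE X Y Z d1 d2 \<noteq> {}"
proof -
  let ?v = "unit_vec (d1 * d2) 0 :: complex vec"
  let ?M = "\<lambda>z. if z = z0 then 1\<^sub>m (d1 * d2) else 0\<^sub>m (d1 * d2) (d1 * d2) :: complex mat"
  have id: "quantum_channel d d (conj_map (1\<^sub>m d))" for d
    by (rule quantum_channel_conj_map) (auto intro!: eq_matI)
  have one: "psd_mat n (1\<^sub>m n)" for n
    by (auto simp: psd_mat_def nonneg_complex_iff scalar_prod_def intro!: add_nonneg_nonneg sum_nonneg)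
  have zero: "psd_mat n (0\<^sub>m n n)" for n
    by (simp add: psd_mat_iff qform_def)
  have "density_mat (d1 * d2) (rank1_proj ?v)"
    using assms by (intro density_mat_rank1_proj) (auto simp: scalar_prod_def unit_vec_def if_distrib cong: if_cong)
  moreover have "povm (d1 * d2) Z ?M"
    unfolding povm_def
  proof (intro conjI ballI)
    show "mat (d1 * d2) (d1 * d2) (\<lambda>ij. \<Sum>z\<in>Z. ?M z $$ ij) = 1\<^sub>m (d1 * d2)"
    proof (rule eq_matI)
      fix r c assume "r < dim_row (1\<^sub>m (d1 * d2) :: complex mat)" "c < dim_col (1\<^sub>m (d1 * d2) :: complex mat)"
      then have rc: "r < d1 * d2" "c < d1 * d2" by auto
      have "(\<Sum>z\<in>Z. ?M z $$ (r, c)) = (\<Sum>z\<in>Z. if z = z0 then 1\<^sub>m (d1 * d2) $$ (r, c) else 0)"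
        using rc by (intro sum.cong refl) auto
      then show "mat (d1 * d2) (d1 * d2) (\<lambda>ij. \<Sum>z\<in>Z. ?M z $$ ij) $$ (r, c) = 1\<^sub>m (d1 * d2) $$ (r, c)"
        using rc assms by simp
    qed auto
  qed (use assms one zero in auto)
  ultimately have "network_dist d1 d2 d1 d2 (rank1_proj ?v) (\<lambda>_. conj_map (1\<^sub>m d1)) (\<lambda>_. conj_map (1\<^sub>m d2)) ?M \<in> QE X Y Z d1 d2"
    unfolding QE_def using id by blast
  then show ?thesis by blast
qed

lemma dnc_protocol_in_QE:
  assumes "finite (carrier G)" "card (carrier G) = d\<^sup>2" "d > 0" and U: "tnc_rep G d U"
  shows "dnc_protocol d U \<in> QE (carrier G) (carrier G) (carrier G) d d"
proof -
  have unit: "unitary_mat d (U g)" if "g \<in> carrier G" for g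
    using U that by (simp add: tnc_rep_def)
  then have Uc: "U g \<in> carrier_mat d d" if "g \<in> carrier G" for g
    using that by (simp add: unitary_mat_def)
  \<comment> \<open>In this form the normalization of the shared state is the case of two identity
    matrices in \<open>max_ent_inner\<close>.\<close>
  have "max_ent d = kron (1\<^sub>m d) (1\<^sub>m d) *\<^sub>v max_ent d"
  proof -
    have "kron (1\<^sub>m d) (1\<^sub>m d) = (1\<^sub>m (d * d) :: complex mat)"
    proof (rule eq_mat_blocksI)
      fix i j p q assume *: "i < d" "j < d" "p < d" "q < d"
      then have "i * d + p = j * d + q \<longleftrightarrow> i = j \<and> p = q"
        by (metis block_index)
      then show "kron (1\<^sub>m d) (1\<^sub>m d) $$ (i * d + p, j * d + q) = (1\<^sub>m (d * d) :: complex mat) $$ (i * d + p, j * d + q)"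
        using * by (simp add: kron_index[OF one_carrier_mat one_carrier_mat])
    qed auto
    then show ?thesis by simp
  qed
  moreover have "mat_adjoint (1\<^sub>m d) * 1\<^sub>m d = (1\<^sub>m d :: complex mat)"
    by (auto intro!: eq_matI)
  ultimately have "max_ent d \<bullet>c max_ent d = 1"
    using max_ent_inner[of "1\<^sub>m d" d "1\<^sub>m d"] \<open>d > 0\<close> by (simp add: mtrace_def)
  then have "density_mat (d * d) (rank1_proj (max_ent d))"
    by (rule density_mat_rank1_proj[rotated]) simp
  moreover have "povm (d * d) (carrier G) (\<lambda>k. rank1_proj (dnc_basis d U k))"
  proof (rule povm_orthonormal_basis)
    fix g h assume gh: "g \<in> carrier G" "h \<in> carrier G"
    show "dnc_basis d U g \<in> carrier_vec (d * d)"
      unfolding dnc_basis_def by (rule mult_mat_vec_carrier[OF kron_carrier[OF Uc[OF gh(1)] one_carrier_mat]]) simp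
    show "dnc_basis d U g \<bullet>c dnc_basis d U h = (if g = h then 1 else 0)"
      unfolding dnc_basis_def max_ent_inner[OF Uc[OF gh(2)] Uc[OF gh(1)]]
      using U gh \<open>d > 0\<close> by (simp add: tnc_rep_def)
  qed (use assms in \<open>auto simp: power2_eq_square\<close>)
  moreover have "\<forall>g\<in>carrier G. quantum_channel d d (conj_map (U g))"
    using unit by (simp add: quantum_channel_unitary)
  moreover have "\<forall>h\<in>carrier G. quantum_channel d d (conj_map (transpose_mat (U h)))"
    using unit by (simp add: quantum_channel_unitary unitary_mat_transpose)
  ultimately show ?thesis
    unfolding dnc_protocol_def QE_def by blast
qed

text \<open>The two encodings produce the basis vector of the product up to a phase, so the outcome
  probability is the squared norm of that unit vector, squared.\<close>

lemma dnc_protocol_correct: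
  assumes "group G" "d > 0" "tnc_rep G d U" and gh: "g \<in> carrier G" "h \<in> carrier G"
  shows "dnc_protocol d U (g \<otimes>\<^bsub>G\<^esub> h) g h = 1"
proof -
  interpret group G by fact
  have Uc: "U k \<in> carrier_mat d d" if "k \<in> carrier G" for k
    using assms(3) that by (simp add: tnc_rep_def unitary_mat_def)
  obtain w where w: "cmod w = 1" "U g * U h = w \<cdot>\<^sub>m U (g \<otimes>\<^bsub>G\<^esub> h)"
    using assms(3) gh unfolding tnc_rep_def by blast
  let ?k = "g \<otimes>\<^bsub>G\<^esub> h"
  let ?b = "dnc_basis d U ?k"
  have k: "?k \<in> carrier G" using gh by simp
  note Ut = transpose_carrier_mat[THEN iffD2, OF Uc[OF gh(2)]]
  \<comment> \<open>The transpose in the encoding of Sender 2 is undone by the one in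
    \<open>kron_max_ent\<close>, leaving the coefficient matrix \<open>U g * U h\<close>.\<close>
  have "kron (U g) (transpose_mat (U h)) *\<^sub>v max_ent d = w \<cdot>\<^sub>v ?b"
    unfolding dnc_basis_def kron_max_ent[OF Uc[OF gh(1)] Ut] kron_max_ent[OF Uc[OF k] one_carrier_mat]
    using w Uc[OF k] by (intro eq_vecI) (auto simp: less_mult_imp_div_less elim!: block_index_cases)
  then have "tensor_map d d d d (conj_map (U g)) (conj_map (transpose_mat (U h))) (rank1_proj (max_ent d)) = rank1_proj ?b"
    using w(1)
    by (simp add: tensor_map_conj_map[OF Uc[OF gh(1)] Ut] rank1_proj_smult
        conj_map_rank1_proj[OF kron_carrier[OF Uc[OF gh(1)] Ut]])
  moreover have "?b \<in> carrier_vec (d * d)"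
    unfolding dnc_basis_def by (rule mult_mat_vec_carrier[OF kron_carrier[OF Uc[OF k] one_carrier_mat]]) simp
  moreover have "?b \<bullet>c ?b = 1"
    unfolding dnc_basis_def max_ent_inner[OF Uc[OF k] Uc[OF k]]
    using assms(2,3) k by (simp add: tnc_rep_def)
  ultimately show ?thesis
    unfolding dnc_protocol_def network_dist_def by (simp add: mtrace_rank1_proj_times)
qed

section \<open>The optimal value and the strict gap\<close>

theorem theorem6:
  fixes G :: "('a, 'b) monoid_scheme" and d :: nat
  assumes "tnc_group G d"
  shows "(\<forall>U. tnc_rep G d U \<longrightarrow>
            dnc_protocol d U \<in> QE (carrier G) (carrier G) (carrier G) d d \<and>
            (\<forall>g\<in>carrier G. \<forall>h\<in>carrier G. dnc_protocol d U (g \<otimes>\<^bsub>G\<^esub> h) g h = 1)) \<and>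
         opt_success_prob (carrier G) (carrier G) (\<lambda>g h. g \<otimes>\<^bsub>G\<^esub> h)
            (QE (carrier G) (carrier G) (carrier G) d d) = 1 \<and>
         (\<forall>d1 d2 :: nat. 0 < d1 \<longrightarrow> 0 < d2 \<longrightarrow> min d1 d2 < d \<longrightarrow>
            opt_success_prob (carrier G) (carrier G) (\<lambda>g h. g \<otimes>\<^bsub>G\<^esub> h)
              (QE (carrier G) (carrier G) (carrier G) d1 d2) < 1)"
proof (intro conjI allI impI ballI)
  let ?X = "carrier G"
  let ?S = "success_prob ?X ?X (\<lambda>g h. g \<otimes>\<^bsub>G\<^esub> h)"
  from assms interpret group G by (simp add: tnc_group_def)
  have fin: "finite ?X" and card: "card ?X = d\<^sup>2"
    using assms by (auto simp: tnc_group_def Coset.order_def)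
  have "card ?X > 0" using fin one_closed by (auto simp: card_gt_0_iff)
  then have d: "d > 0" using card by simp
  have bound: "?S Q \<le> real ((min d1 d2)\<^sup>2) / real (d\<^sup>2)" if "Q \<in> QE ?X ?X ?X d1 d2" for Q d1 d2
    using success_prob_le[OF fin that] card by simp
  {
    fix U assume U: "tnc_rep G d U"
    show mem: "dnc_protocol d U \<in> QE ?X ?X ?X d d"
      by (rule dnc_protocol_in_QE[OF fin card d U])
    fix g h assume "g \<in> ?X" "h \<in> ?X"
    then show "dnc_protocol d U (g \<otimes>\<^bsub>G\<^esub> h) g h = 1"
      by (rule dnc_protocol_correct[OF is_group d U])
  }
  obtain U where U: "tnc_rep G d U" using assms by (auto simp: tnc_group_def)
  have "?S (dnc_protocol d U) = 1"
    using dnc_protocol_correct[OF is_group d U] card d by (simp add: success_prob_def)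
  \<comment> \<open>For both dimensions equal to d the bound is 1 and the protocol attains it, so
    the supremum is a maximum.\<close>
  then show "opt_success_prob ?X ?X (\<lambda>g h. g \<otimes>\<^bsub>G\<^esub> h) (QE ?X ?X ?X d d) = 1"
    unfolding opt_success_prob_def
    using dnc_protocol_in_QE[OF fin card d U] bound[where ?d1.0 = d and ?d2.0 = d] d
    by (intro cSup_eq_maximum) (auto intro: image_eqI[rotated])
  fix d1 d2 :: nat assume pos: "0 < d1" "0 < d2" and less: "min d1 d2 < d"
  \<comment> \<open>The bound is uniform over all strategies, so it passes to the supremum and
    strictness is not lost.\<close>
  have "opt_success_prob ?X ?X (\<lambda>g h. g \<otimes>\<^bsub>G\<^esub> h) (QE ?X ?X ?X d1 d2)
      \<le> real ((min d1 d2)\<^sup>2) / real (d\<^sup>2)"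
    unfolding opt_success_prob_def
    using QE_nonempty[OF fin one_closed pos] bound by (rule cSUP_least)
  also have "\<dots> < 1"
  proof -
    have "(min d1 d2)\<^sup>2 < d\<^sup>2" using less by (intro power_strict_mono) auto
    then have "real ((min d1 d2)\<^sup>2) < real (d\<^sup>2)" by (simp only: of_nat_less_iff)
    then show ?thesis using d by simp
  qed
  finally show "opt_success_prob ?X ?X (\<lambda>g h. g \<otimes>\<^bsub>G\<^esub> h) (QE ?X ?X ?X d1 d2) < 1" .
qed

end
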